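(* Let $\Sigma=\{L,X,R\}$ and let $\mathbf{O}=(\Sigma^*,\preceq)$ be the partial order on the set $\Sigma^*$ of finite words over $\Sigma$ where $w\preceq w'$ iff $w=w'$ or there exists $0\le i<\min(|w|,|w'|)$ with $(w_i,w'_i)=(L,R)$ and $w_j\le_{\mathrm{lex}}w'_j$ for all $0\le j<i$ (with $L<_{\mathrm{lex}}X<_{\mathrm{lex}}R$). Then for every finite $k\ge1$ and every colouring $\chi$ with finitely many colours of the (induced) suborders of $\mathbf{O}$ with $k$ elements (equivalently, of the $k$-element subsets of $\Sigma^*$), there exists an embedding $f\colon\mathbf{O}\to\mathbf{O}$ such that the colour of every $k$-element suborder $\mathbf{A}$ of $f(\mathbf{O})$ depends only on $\tau(f^{-1}[A])$; that is, for any two $k$-element subsets $A,A'$ of $f[\Sigma^*]$ with $\tau(f^{-1}[A])=\tau(f^{-1}[A'])$ we have $\chi(A)=\chi(A')$.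
   Context: $|w|$ is the length of a string and $w_j$ its letter at index $j$ (indices start at $0$). A $k$-parameter word over $\Sigma$ ($k\in\omega\cup\{\omega\}$) is a (finite or infinite) string $W$ over $\Sigma\cup\{\lambda_i:0\le i<k\}$ (new symbols called parameters) containing each $\lambda_i$, $0\le i<k$, such that for every $1\le j<k$ the first occurrence of $\lambda_j$ is after the first occurrence of $\lambda_{j-1}$; $0$-parameter words are ordinary words. If $W$ is an $n$-parameter word and $U$ a parameter word of length $m\le n$, $W(U)$ is obtained from $W$ by replacing each occurrence of $\lambda_i$, $0\le i<m$, by $U_i$ and truncating just before the first occurrence of $\lambda_m$ in $W$ (no truncation if $m=n$); $W(T)=\{W(U):U\in T\}$. An envelope of a set $S$ of parameter words is a parameter word $W$ such that every $U\in S$ equals $W(U')$ for some parameter word $U'$; it is minimal if no envelope of $S$ has fewer parameters. For an envelope $W$ of $S$, $\tau_W(S)$ is the set $T$ of parameter words with $W(T)=S$. For a finite set $S$ of finite words, $\tau(S)$ denotes $\tau_W(S)$ for any minimal envelope $W$ of $S$ (independent of the choice of $W$). *)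

theory Defs
  imports Main "HOL-Library.Stream" "HOL-Library.Extended_Nat"
begin

datatype 'a fistring = Fin "'a list" | Inf "'a stream"

fun slen :: "'a fistring \<Rightarrow> enat" where
  "slen (Fin w) = enat (length w)"
| "slen (Inf s) = \<infinity>"

text \<open>The letter at an index; it is meaningful only below the length of the string.\<close>

fun letter_at :: "'a fistring \<Rightarrow> nat \<Rightarrow> 'a" where
  "letter_at (Fin w) j = w ! j"
| "letter_at (Inf s) j = s !! j"

fun truncate :: "nat \<Rightarrow> 'a fistring \<Rightarrow> 'a fistring" where
  "truncate p (Fin w) = Fin (take p w)"
| "truncate p (Inf s) = Fin (stake p s)"

definition occurs :: "'a \<Rightarrow> 'a fistring \<Rightarrow> bool" where
  "occurs c w \<longleftrightarrow> (\<exists>j. enat j < slen w \<and> letter_at w j = c)"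

definition first_occ :: "'a \<Rightarrow> 'a fistring \<Rightarrow> nat" where
  "first_occ c w = (LEAST j. enat j < slen w \<and> letter_at w j = c)"

text \<open>\<open>Par i\<close> is the parameter $\lambda_i$. The number of parameters ranges over \<open>enat\<close>,
  where \<open>\<infinity>\<close> plays the role of $\omega$.\<close>

datatype 'a sym = Ltr 'a | Par nat

definition param_word :: "enat \<Rightarrow> 'a sym fistring \<Rightarrow> bool" where
  "param_word k W \<longleftrightarrow>
     (\<forall>i. occurs (Par i) W \<longleftrightarrow> enat i < k) \<and>
     (\<forall>j. 1 \<le> j \<and> enat j < k \<longrightarrow> first_occ (Par (j - 1)) W < first_occ (Par j) W)"

fun subst_sym :: "'a sym fistring \<Rightarrow> 'a sym \<Rightarrow> 'a sym" where
  "subst_sym U (Ltr a) = Ltr a"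
| "subst_sym U (Par i) = letter_at U i"

text \<open>\<open>substitutable W U\<close> is the condition under which $W(U)$ is defined.\<close>

definition substitutable :: "'a sym fistring \<Rightarrow> 'a sym fistring \<Rightarrow> bool" where
  "substitutable W U \<longleftrightarrow>
     (\<exists>n k. param_word n W \<and> param_word k U \<and> slen U \<le> n)"

text \<open>\<open>subst W U\<close> is $W(U)$. If $U$ has length $m \le n$, where $n$ is the number of
  parameters of $W$, then $\lambda_m$ occurs in $W$ exactly when $m < n$, so there is no
  truncation when $m = n$ (in particular when $U$ is infinite).\<close>

definition subst :: "'a sym fistring \<Rightarrow> 'a sym fistring \<Rightarrow> 'a sym fistring" where
  "subst W U = map_fistring (subst_sym U)
     (case slen U of
        enat m \<Rightarrow> if occurs (Par m) W then truncate (first_occ (Par m) W) W else W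
      | \<infinity> \<Rightarrow> W)"

definition envelope :: "'a sym fistring \<Rightarrow> 'a sym fistring set \<Rightarrow> bool" where
  "envelope W S \<longleftrightarrow>
     (\<exists>n. param_word n W) \<and> (\<forall>U\<in>S. \<exists>U'. substitutable W U' \<and> subst W U' = U)"

definition minimal_envelope :: "'a sym fistring \<Rightarrow> 'a sym fistring set \<Rightarrow> bool" where
  "minimal_envelope W S \<longleftrightarrow> envelope W S \<and>
     (\<forall>W' n n'. envelope W' S \<and> param_word n W \<and> param_word n' W' \<longrightarrow> n \<le> n')"

definition tau_env :: "'a sym fistring \<Rightarrow> 'a sym fistring set \<Rightarrow> 'a sym fistring set" where
  "tau_env W S = (THE T. (\<forall>U\<in>T. substitutable W U) \<and> subst W ` T = S)"

text \<open>Substitution into a fixed $W$ is injective, hence the definite description in \<open>tau_env\<close>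
  is well defined for every envelope.\<close>

lemma fistring_eqI:
  assumes "slen U = slen V" "\<And>i. enat i < slen U \<Longrightarrow> letter_at U i = letter_at V i"
  shows "U = V"
proof (cases U)
  case (Fin u)
  then show ?thesis using assms by (cases V) (auto intro: nth_equalityI)
next
  case (Inf u)
  with assms(1) obtain v where V: "V = Inf v" by (cases V) auto
  have "smap ((!!) u) nats = smap ((!!) v) nats" if "(!!) u = (!!) v"
    using that by simp
  moreover have "(!!) u = (!!) v" using assms(2) Inf V by auto
  ultimately show ?thesis using Inf V by (metis stream_smap_nats)
qed

definition stop_at :: "'a sym fistring \<Rightarrow> 'a sym fistring \<Rightarrow> enat" where
  "stop_at W U = (case slen U of
     enat m \<Rightarrow> if occurs (Par m) W then enat (first_occ (Par m) W) else slen W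
   | \<infinity> \<Rightarrow> slen W)"

lemma first_occ_props:
  assumes "occurs c W"
  shows "enat (first_occ c W) < slen W" "letter_at W (first_occ c W) = c"
  using LeastI_ex[OF assms[unfolded occurs_def]] unfolding first_occ_def by auto

lemma slen_truncate: "enat p \<le> slen W \<Longrightarrow> slen (truncate p W) = enat p"
  by (cases W) auto

lemma letter_at_truncate: "j < p \<Longrightarrow> letter_at (truncate p W) j = letter_at W j"
  by (cases W) auto

lemma slen_map: "slen (map_fistring g W) = slen W"
  by (cases W) auto

lemma letter_at_map: "enat j < slen W \<Longrightarrow> letter_at (map_fistring g W) j = g (letter_at W j)"
  by (cases W) auto

lemma slen_subst: "slen (subst W U) = stop_at W U"
  unfolding subst_def stop_at_def
  by (auto simp: slen_map slen_truncate first_occ_props(1) less_imp_le split: enat.split)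

lemma letter_at_subst:
  assumes "enat j < stop_at W U"
  shows "letter_at (subst W U) j = subst_sym U (letter_at W j)"
  using assms unfolding subst_def stop_at_def
  by (auto simp: slen_map slen_truncate letter_at_map letter_at_truncate first_occ_props(1)
        less_imp_le split: enat.splits if_splits)

lemma first_occ_less_stop_at:
  assumes W: "param_word n W" and i: "enat i < slen U" and n: "slen U \<le> n"
  shows "enat (first_occ (Par i) W) < stop_at W U"
proof -
  have occ: "occurs (Par j) W \<longleftrightarrow> enat j < n" for j
    using W unfolding param_word_def by blast
  have step: "first_occ (Par j) W < first_occ (Par (Suc j)) W" if "enat (Suc j) < n" for j
    using W that unfolding param_word_def by (metis diff_Suc_1 le_add1 plus_1_eq_Suc)
  have mono: "first_occ (Par i) W < first_occ (Par (Suc (i + d))) W"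
    if "enat (Suc (i + d)) < n" for d
    using that
  proof (induction d)
    case 0
    then show ?case using step by simp
  next
    case (Suc d)
    have "enat (Suc (i + d)) < n"
      using Suc.prems by (metis add_Suc_right enat_ord_simps(2) less_trans lessI)
    then show ?case using Suc step[of "Suc (i + d)"] by fastforce
  qed
  have "occurs (Par i) W" using occ i n by (meson order_less_le_trans)
  then have len: "enat (first_occ (Par i) W) < slen W" by (rule first_occ_props)
  show ?thesis
  proof (cases "slen U")
    case (enat m)
    then obtain d where "m = Suc (i + d)" using i less_imp_Suc_add by fastforce
    then show ?thesis using len enat mono[of d] occ[of m] by (auto simp: stop_at_def)
  qed (use len in \<open>auto simp: stop_at_def\<close>)
qed

lemma subst_inj:
  assumes "substitutable W U" "substitutable W V" and eq: "subst W U = subst W V"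
  shows "U = V"
proof -
  obtain n n' where n: "param_word n W" "slen U \<le> n" and n': "param_word n' W" "slen V \<le> n'"
    using assms unfolding substitutable_def by blast
  have lt: "enat i < n \<longleftrightarrow> enat i < n'" for i
    using n n' unfolding param_word_def by blast
  have "\<not> n < n'"
  proof
    assume "n < n'"
    then obtain i where "n = enat i" by (cases n) auto
    then show False using lt[of i] \<open>n < n'\<close> by simp
  qed
  moreover have "\<not> n' < n"
  proof
    assume "n' < n"
    then obtain i where "n' = enat i" by (cases n') auto
    then show False using lt[of i] \<open>n' < n\<close> by simp
  qed
  ultimately have "n = n'" by simp
  have stop: "stop_at W U = stop_at W V" using eq by (metis slen_subst)
  have less: False
    if UV: "slen A < slen B" and B: "slen B \<le> n" and s: "stop_at W A = stop_at W B" for A B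
  proof -
    obtain m where m: "slen A = enat m" using UV by (cases "slen A") auto
    have "enat m < n" using UV B m by simp
    then have "stop_at W A = enat (first_occ (Par m) W)"
      using n(1) m by (auto simp: stop_at_def param_word_def)
    moreover have "enat (first_occ (Par m) W) < stop_at W B"
      using first_occ_less_stop_at[OF n(1) _ B] UV m by simp
    ultimately show False using s by simp
  qed
  have len: "slen U = slen V"
    using less[of U V] less[of V U] stop n(2) n'(2) \<open>n = n'\<close> by fastforce
  show ?thesis
  proof (rule fistring_eqI[OF len])
    fix i assume i: "enat i < slen U"
    let ?j = "first_occ (Par i) W"
    have j: "enat ?j < stop_at W U" using first_occ_less_stop_at[OF n(1) i n(2)] .
    have "letter_at W ?j = Par i"
      using i n by (intro first_occ_props) (auto simp: param_word_def)
    then show "letter_at U i = letter_at V i"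
      using letter_at_subst[OF j] letter_at_subst[of ?j W V] j stop eq by simp
  qed
qed

lemma tau_env_unique:
  assumes "envelope W S"
  shows "\<exists>!T. (\<forall>U\<in>T. substitutable W U) \<and> subst W ` T = S"
proof (rule ex_ex1I)
  show "\<exists>T. (\<forall>U\<in>T. substitutable W U) \<and> subst W ` T = S"
    using assms unfolding envelope_def
    by (intro exI[of _ "{U. substitutable W U \<and> subst W U \<in> S}"]) force
next
  fix T T'
  assume "(\<forall>U\<in>T. substitutable W U) \<and> subst W ` T = S"
    "(\<forall>U\<in>T'. substitutable W U) \<and> subst W ` T' = S"
  moreover have "inj_on (subst W) {U. substitutable W U}"
    using subst_inj by (auto intro!: inj_onI)
  ultimately show "T = T'"
    using inj_on_image_eq_iff[of "subst W" "{U. substitutable W U}" T T'] by blast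
qed

definition word_of :: "'a list \<Rightarrow> 'a sym fistring" where
  "word_of w = Fin (map Ltr w)"

text \<open>$\tau_W(S)$ does not depend on the minimal envelope $W$; one is picked.\<close>

definition tau :: "'a list set \<Rightarrow> 'a sym fistring set" where
  "tau S = tau_env (SOME W. minimal_envelope W (word_of ` S)) (word_of ` S)"

datatype letter = L | X | R

instantiation letter :: linorder
begin

fun letter_rank :: "letter \<Rightarrow> nat" where
  "letter_rank L = 0" | "letter_rank X = 1" | "letter_rank R = 2"

definition less_eq_letter :: "letter \<Rightarrow> letter \<Rightarrow> bool" where
  "a \<le> b \<longleftrightarrow> letter_rank a \<le> letter_rank b"

definition less_letter :: "letter \<Rightarrow> letter \<Rightarrow> bool" where
  "a < b \<longleftrightarrow> letter_rank a < letter_rank b"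

instance
proof
  fix a b :: letter
  show "a = b" if "a \<le> b" "b \<le> a"
    using that by (cases a; cases b; simp add: less_eq_letter_def)
qed (auto simp: less_eq_letter_def less_letter_def)

end

definition preceq :: "letter list \<Rightarrow> letter list \<Rightarrow> bool"  (infix "\<preceq>" 50) where
  "w \<preceq> w' \<longleftrightarrow> w = w' \<or>
     (\<exists>i < min (length w) (length w').
        w ! i = L \<and> w' ! i = R \<and> (\<forall>j<i. w ! j \<le> w' ! j))"

definition order_embedding :: "(letter list \<Rightarrow> letter list) \<Rightarrow> bool" where
  "order_embedding f \<longleftrightarrow> inj f \<and> (\<forall>w w'. f w \<preceq> f w' \<longleftrightarrow> w \<preceq> w')"

lemma letter_order_simps: "\<not> R \<le> L" "R \<le> a \<longleftrightarrow> a = R" "a \<le> L \<longleftrightarrow> a = L"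
  by (cases a; simp add: less_eq_letter_def)+

lemma preceq_partial_order: "partial_order_on UNIV {(w, w'). w \<preceq> w'}"
proof -
  have tr: "u \<preceq> w" if uv: "u \<preceq> v" and vw: "v \<preceq> w" for u v w
  proof (cases "u = v \<or> v = w")
    case True
    then show ?thesis using uv vw by auto
  next
    case False
    then obtain i j where
      i: "i < length u" "i < length v" "u ! i = L" "v ! i = R" "\<forall>l<i. u ! l \<le> v ! l" and
      j: "j < length v" "j < length w" "v ! j = L" "w ! j = R" "\<forall>l<j. v ! l \<le> w ! l"
      using uv vw unfolding preceq_def by auto
    let ?m = "min i j"
    have "i \<noteq> j" using i j by auto
    then have "u ! ?m = L \<and> w ! ?m = R"
      using i j letter_order_simps by (metis linorder_neqE_nat min.strict_order_iff min.commute)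
    moreover have "\<forall>l<?m. u ! l \<le> w ! l" using i(5) j(5) by (meson min_less_iff_conj order_trans)
    moreover have "?m < min (length u) (length w)" using i j by auto
    ultimately show ?thesis unfolding preceq_def by blast
  qed
  have an: "u = v" if uv: "u \<preceq> v" and vu: "v \<preceq> u" for u v
  proof (rule ccontr)
    assume "u \<noteq> v"
    then obtain i j where
      "u ! i = L" "v ! i = R" "\<forall>l<i. u ! l \<le> v ! l"
      "v ! j = L" "u ! j = R" "\<forall>l<j. v ! l \<le> u ! l"
      using uv vu unfolding preceq_def by auto
    then show False
      using letter_order_simps by (metis letter.distinct(4) linorder_neqE_nat)
  qed
  show ?thesis
    unfolding partial_order_on_def preorder_on_def refl_on_def trans_def antisym_def
    using tr an by (auto simp: preceq_def[of x x for x])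
qed

end

theory Submission
  imports Defs "HOL-Library.Sublist" "HOL-Library.FuncSet"
begin

text \<open>An infinite parameter word \<open>W\<close> induces the embedding $w \mapsto W(w)$ of the order. A set \<open>S\<close> of
  \<open>k\<close> words is $E(T)$ with \<open>T = tau S\<close> and $E$ a finite parameter word whose number of parameters is
  bounded in terms of \<open>k\<close>. Its image is then $W(E(T)) = (W(E))(T)$, so colour $E$ by the function that
  maps each of the finitely many possible \<open>T\<close> to the colour of $E(T)$ and take \<open>W\<close> such that
  the colour of $W(E)$ depends only on the number of parameters of $E$.

  Such a \<open>W\<close> exists by the Carlson-Simpson theorem. For words without parameters it comes from an
  idempotent ultrafilter of variable words, all of whose instances are the same minimal idempotent
  ultrafilter of words. The step to more parameters regards the first parameter of $E$ as a
  new letter and fuses the words obtained for the finite initial segments.\<close>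

section \<open>Idempotent ultrafilters of words\<close>

text \<open>Two sets with the same T may come from unrelated words E and E'. They can be compared
  only because T also determines the number of parameters: E is cut so that it has as many
  parameters as the longest word of T has letters. This number is not a function of k. It is at most
  4^k, the number of columns of k entries, each one of the three letters or the mark of a word that
  has ended.

  The shape of the construction of W is dictated by truncation. The image of a word stops just
  before the next parameter, so the colour must be controlled on a word followed by the beginning of
  a variable word, not on instances of whole variable words.

  Minimality of the idempotent is what makes all instances equal: substituting a letter for the
  variable is a homomorphism that fixes words, so it sends q to an idempotent below p, and below a
  minimal p there is no other.\<close>

definition concat_filter :: "'a list filter \<Rightarrow> 'a list filter \<Rightarrow> 'a list filter"  (infixl "\<star>" 70) where
  "F \<star> G = Abs_filter (\<lambda>P. \<forall>\<^sub>F x in F. \<forall>\<^sub>F y in G. P (x @ y))"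

text \<open>On ultrafilters this is the extension of concatenation to the Stone-Cech
  compactification of the free monoid. It is taken for all filters because a filter stands for the
  closed set of ultrafilters below it, with \<open>\<le>\<close> as inclusion and \<open>bot\<close>
  as the empty set.\<close>

lemma eventually_concat_filter:
  "eventually P (F \<star> G) \<longleftrightarrow> (\<forall>\<^sub>F x in F. \<forall>\<^sub>F y in G. P (x @ y))"
  unfolding concat_filter_def
proof (rule eventually_Abs_filter, rule is_filter.intro)
  fix P Q assume "\<forall>\<^sub>F x in F. \<forall>\<^sub>F y in G. P (x @ y)" "\<forall>\<^sub>F x in F. \<forall>\<^sub>F y in G. Q (x @ y)"
  then show "\<forall>\<^sub>F x in F. \<forall>\<^sub>F y in G. P (x @ y) \<and> Q (x @ y)"
    by eventually_elim (rule eventually_conj)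
next
  fix P Q assume "\<forall>x. P x \<longrightarrow> Q x" "\<forall>\<^sub>F x in F. \<forall>\<^sub>F y in G. P (x @ y)"
  then show "\<forall>\<^sub>F x in F. \<forall>\<^sub>F y in G. Q (x @ y)"
    by (elim eventually_mono) auto
qed auto

lemma concat_filter_assoc: "F \<star> G \<star> H = F \<star> (G \<star> H)"
  by (simp add: filter_eq_iff eventually_concat_filter)

lemma concat_filter_mono:
  assumes "F \<le> F'" "G \<le> G'"
  shows "F \<star> G \<le> F' \<star> G'"
proof (rule filter_leI)
  fix P assume "eventually P (F' \<star> G')"
  then have "\<forall>\<^sub>F x in F. \<forall>\<^sub>F y in G'. P (x @ y)"
    using assms(1) by (simp add: eventually_concat_filter le_filter_def)
  then show "eventually P (F \<star> G)"
    unfolding eventually_concat_filter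
    by (rule eventually_mono) (rule filter_leD[OF assms(2)])
qed

lemma concat_filter_eq_bot: "F \<star> G = bot \<longleftrightarrow> F = bot \<or> G = bot"
  by (simp add: trivial_limit_def eventually_concat_filter)
     (cases "eventually (\<lambda>x. False) G"; simp)

lemma filtermap_concat_filter:
  "filtermap (map g) (F \<star> G) = filtermap (map g) F \<star> filtermap (map g) G"
  by (simp add: filter_eq_iff eventually_concat_filter eventually_filtermap)

lemma concat_filter_principal_le:
  assumes "\<And>x y. x \<in> A \<Longrightarrow> y \<in> B \<Longrightarrow> x @ y \<in> C"
  shows "principal A \<star> principal B \<le> principal C"
  using assms by (auto simp: le_filter_def eventually_concat_filter eventually_principal)

text \<open>Zorn's lemma with compactness built in: an event of the infimum of a chain is already
  one of some member, so the infimum is proper. The instances are ultrafilters (\<open>op\<close>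
  the identity), subsemigroups (\<open>F \<star> F\<close>) and left ideals
  (\<open>S \<star> F\<close>).\<close>

lemma minimal_prefixed_filter:
  fixes op :: "'a filter \<Rightarrow> 'a filter"
  assumes op: "mono op" and G: "G \<noteq> bot" "op G \<le> G"
  obtains F where "F \<le> G" "F \<noteq> bot" "op F \<le> F"
    "\<And>F'. F' \<le> F \<Longrightarrow> F' \<noteq> bot \<Longrightarrow> op F' \<le> F' \<Longrightarrow> F' = F"
proof -
  define A where "A = {F. F \<le> G \<and> F \<noteq> bot \<and> op F \<le> F}"
  have "\<exists>m\<in>A. \<forall>a\<in>A. m \<ge> a \<longrightarrow> a = m"
  proof (rule predicate_Zorn)
    show "partial_order_on A (relation_of (\<ge>) A)"
      by (rule partial_order_on_relation_ofI) auto
    fix C assume C: "C \<in> Chains (relation_of (\<ge>) A)"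
    then have CA: "C \<subseteq> A" unfolding Chains_def relation_of_def by blast
    show "\<exists>u\<in>A. \<forall>a\<in>C. a \<ge> u"
    proof (cases "C = {}")
      case True
      then show ?thesis using G by (auto simp: A_def)
    next
      case False
      have "\<exists>x\<in>C. x \<le> inf F F'" if "F \<in> C" "F' \<in> C" for F F'
        using C that unfolding Chains_def relation_of_def
        by (cases "F \<le> F'") (auto simp: inf_absorb1 inf_absorb2)
      then have ev: "eventually P (Inf_class.Inf C) \<longleftrightarrow> (\<exists>b\<in>C. eventually P b)" for P
        using False by (intro eventually_Inf_base) auto
      have "Inf_class.Inf C \<noteq> bot"
        using CA ev unfolding A_def trivial_limit_def by blast
      moreover have "op (Inf_class.Inf C) \<le> Inf_class.Inf C"
      proof (rule Inf_greatest)
        fix F assume F: "F \<in> C"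
        then have "op (Inf_class.Inf C) \<le> op F" using op by (simp add: Inf_lower monoD)
        also have "\<dots> \<le> F" using F CA by (auto simp: A_def)
        finally show "op (Inf_class.Inf C) \<le> F" .
      qed
      moreover have "Inf_class.Inf C \<le> G"
        using False CA unfolding A_def by (metis (mono_tags, lifting) Inf_lower2 equals0I in_mono mem_Collect_eq)
      ultimately show ?thesis by (auto simp: A_def Inf_lower)
    qed
  qed
  then obtain F where F: "F \<in> A" and min: "\<And>a. a \<in> A \<Longrightarrow> a \<le> F \<Longrightarrow> a = F" by blast
  show thesis
  proof (rule that)
    fix F' assume "F' \<le> F" "F' \<noteq> bot" "op F' \<le> F'"
    then show "F' = F" using F min[of F'] by (auto simp: A_def)
  qed (use F in \<open>auto simp: A_def\<close>)
qed

definition ultra :: "'a filter \<Rightarrow> bool" where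
  "ultra F \<longleftrightarrow> F \<noteq> bot \<and> (\<forall>P. eventually P F \<or> (\<forall>\<^sub>F x in F. \<not> P x))"

lemma ultra_not:
  assumes "ultra F"
  shows "(\<forall>\<^sub>F x in F. \<not> P x) \<longleftrightarrow> \<not> eventually P F"
proof
  assume "\<forall>\<^sub>F x in F. \<not> P x"
  then show "\<not> eventually P F"
    using assms not_eventuallyD[of "\<lambda>x. \<not> P x" F] eventually_frequently[of F P]
    by (auto simp: ultra_def frequently_def)
qed (use assms in \<open>auto simp: ultra_def\<close>)

lemma ultra_nonbot: "ultra F \<Longrightarrow> F \<noteq> bot"
  by (simp add: ultra_def)

lemma ultra_concat: "ultra F \<Longrightarrow> ultra G \<Longrightarrow> ultra (F \<star> G)"
  using ultra_not[of F] ultra_not[of G]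
  by (auto simp: ultra_def concat_filter_eq_bot eventually_concat_filter)

lemma ultra_filtermap: "ultra F \<Longrightarrow> ultra (filtermap f F)"
  by (simp add: ultra_def filtermap_bot_iff eventually_filtermap)

lemma ultra_finite_range:
  assumes "ultra F" "finite (range \<chi>)"
  obtains c where "\<forall>\<^sub>F x in F. \<chi> x = c"
proof -
  have "\<exists>c\<in>range \<chi>. \<forall>\<^sub>F x in F. \<chi> x = c"
  proof (rule ccontr)
    assume "\<not> ?thesis"
    then have "\<forall>c\<in>range \<chi>. \<forall>\<^sub>F x in F. \<chi> x \<noteq> c"
      using ultra_not[OF assms(1)] by blast
    then have "\<forall>\<^sub>F x in F. \<forall>c\<in>range \<chi>. \<chi> x \<noteq> c"
      by (rule eventually_ball_finite[OF assms(2)])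
    then have "\<forall>\<^sub>F x in F. False" by (rule eventually_mono) blast
    then show False using ultra_nonbot[OF assms(1)] by (simp add: trivial_limit_def)
  qed
  then show thesis using that by blast
qed

lemma ultra_exists:
  assumes "G \<noteq> bot"
  obtains F where "F \<le> G" "ultra F"
proof -
  obtain F where F: "F \<le> G" "F \<noteq> bot" and min: "\<And>F'. F' \<le> F \<Longrightarrow> F' \<noteq> bot \<Longrightarrow> F' = F"
    using minimal_prefixed_filter[of "\<lambda>F. F" G] assms by (auto simp: mono_def)
  have "eventually P F \<or> (\<forall>\<^sub>F x in F. \<not> P x)" for P
  proof (cases "inf F (principal {x. P x}) = bot")
    case True
    then show ?thesis
      by (simp add: trivial_limit_def eventually_inf_principal)
  next
    case False
    then have "F \<le> principal {x. P x}" using min[of "inf F (principal {x. P x})"]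
      by (metis inf.cobounded1 inf.cobounded2)
    then show ?thesis by (simp add: le_principal)
  qed
  then show thesis using that F by (auto simp: ultra_def)
qed

text \<open>Ellis' lemma. The closed subsemigroups of the space of ultrafilters correspond to the
  filters \<open>F\<close> with \<open>F \<star> F \<le> F\<close>, and a minimal one is a single idempotent.\<close>

lemma idempotent_ultra_exists:
  assumes "G \<noteq> bot" "G \<star> G \<le> G"
  obtains p where "p \<le> G" "ultra p" "p \<star> p = p"
proof -
  obtain F where F: "F \<le> G" "F \<noteq> bot" "F \<star> F \<le> F"
    and min: "\<And>F'. F' \<le> F \<Longrightarrow> F' \<noteq> bot \<Longrightarrow> F' \<star> F' \<le> F' \<Longrightarrow> F' = F"
    using minimal_prefixed_filter[of "\<lambda>F. F \<star> F" G] assms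
    by (auto simp: mono_def concat_filter_mono)
  obtain q where q: "q \<le> F" "ultra q" using ultra_exists F(2) by blast
  \<comment> \<open>\<open>F \<star> q\<close> lies below \<open>F\<close> and is again closed under
    the product, so minimality applies.\<close>
  have "F \<star> q = F"
  proof (rule min)
    show "F \<star> q \<le> F" using concat_filter_mono[OF order_refl q(1), of F] F(3) by simp
    then show "(F \<star> q) \<star> (F \<star> q) \<le> F \<star> q"
      using concat_filter_mono[of "F \<star> q \<star> F" F q q] concat_filter_mono[of "F \<star> q" F F F] F(3)
      by (simp add: concat_filter_assoc)
    show "F \<star> q \<noteq> bot" using F(2) q(2) by (simp add: concat_filter_eq_bot ultra_nonbot)
  qed
  \<comment> \<open>\<open>r \<le> D\<close> says \<open>r \<star> q \<le> q\<close>, with one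
    generating event for each event \<open>A\<close> of \<open>q\<close>. If \<open>D\<close> did
    not meet \<open>F\<close>, the negation of some such \<open>A\<close> would hold in
    \<open>F \<star> q = F\<close>, hence in \<open>q\<close>.\<close>
  define D where "D = (INF A\<in>{A. eventually A q}. principal {x. \<forall>\<^sub>F y in q. A (x @ y)})"
  have ev_D: "eventually P D \<longleftrightarrow>
      (\<exists>A\<in>{A. eventually A q}. eventually P (principal {x. \<forall>\<^sub>F y in q. A (x @ y)}))" for P
    unfolding D_def
  proof (rule eventually_INF_base)
    fix A B assume "A \<in> {A. eventually A q}" "B \<in> {A. eventually A q}"
    then show "\<exists>C\<in>{A. eventually A q}. principal {x. \<forall>\<^sub>F y in q. C (x @ y)}
        \<le> inf (principal {x. \<forall>\<^sub>F y in q. A (x @ y)}) (principal {x. \<forall>\<^sub>F y in q. B (x @ y)})"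
      by (intro bexI[of _ "\<lambda>x. A x \<and> B x"]) (auto simp: eventually_conj_iff)
  qed (auto intro: exI[of _ "\<lambda>_. True"])
  have nonbot: "inf F D \<noteq> bot"
  proof
    assume "inf F D = bot"
    then obtain Q A where Q: "eventually Q F" and A: "eventually A q"
      and no: "\<And>x. Q x \<Longrightarrow> \<not> (\<forall>\<^sub>F y in q. A (x @ y))"
      by (auto simp: trivial_limit_def eventually_inf ev_D eventually_principal)
    have "\<forall>\<^sub>F x in F. \<forall>\<^sub>F y in q. \<not> A (x @ y)"
      using Q by eventually_elim (use no ultra_not[OF q(2)] in blast)
    then have "eventually (\<lambda>x. \<not> A x) (F \<star> q)" by (simp add: eventually_concat_filter)
    then have "eventually (\<lambda>x. \<not> A x) q" using \<open>F \<star> q = F\<close> q(1) by (simp add: le_filter_def)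
    then show False using A ultra_not[OF q(2)] by blast
  qed
  \<comment> \<open>The stabiliser of \<open>q\<close> in \<open>F\<close>. The supremum keeps the
    property because \<open>\<star>\<close> respects suprema on the left. It is closed under the
    product, so \<open>J = F\<close> by minimality, and then
    \<open>F = F \<star> q \<le> q\<close>.\<close>
  define J where "J = Sup {J. J \<le> F \<and> J \<star> q \<le> q}"
  have Jq: "J \<star> q \<le> q"
    by (auto simp: J_def le_filter_def eventually_concat_filter eventually_Sup)
  have JF: "J \<le> F" by (auto simp: J_def intro: Sup_least)
  have "inf F D \<star> q \<le> q"
    unfolding le_filter_def eventually_concat_filter
  proof (intro allI impI)
    fix A assume "eventually A q"
    then have "\<forall>\<^sub>F x in D. \<forall>\<^sub>F y in q. A (x @ y)" by (auto simp: ev_D eventually_principal)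
    then show "\<forall>\<^sub>F x in inf F D. \<forall>\<^sub>F y in q. A (x @ y)"
      by (meson inf.cobounded2 le_filter_def)
  qed
  then have "inf F D \<le> J" by (auto simp: J_def intro: Sup_upper)
  then have "J \<noteq> bot" using nonbot bot.extremum_uniqueI by blast
  moreover have "J \<star> J \<le> J"
  proof -
    have "J \<star> J \<star> q \<le> q"
      using concat_filter_mono[OF order_refl Jq, of J] Jq by (simp add: concat_filter_assoc)
    moreover have "J \<star> J \<le> F" using concat_filter_mono[OF JF JF] F(3) by simp
    ultimately show ?thesis by (auto simp: J_def intro: Sup_upper)
  qed
  ultimately have "J = F" using min JF by blast
  then have "F = q" using Jq \<open>F \<star> q = F\<close> q(1) by auto
  then have "q \<star> q = q" using \<open>F \<star> q = F\<close> by simp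
  then show thesis using that q F(1) \<open>F = q\<close> by blast
qed

text \<open>An idempotent is a right identity on the left ideal that it generates.\<close>

lemma idempotent_right_identity:
  assumes p: "ultra p" "p \<star> p = p" and r: "ultra r" "r \<le> G \<star> p"
  shows "r \<star> p = r"
proof -
  \<comment> \<open>\<open>r\<close> need not be a product with \<open>p\<close>, so the identity is
    shown event by event: by idempotence, for every \<open>x\<close> and \<open>p\<close>-most
    \<open>y\<close>, \<open>A\<close> holds at \<open>x @ y\<close> iff it holds at
    \<open>p\<close>-most extensions of \<open>x @ y\<close>.\<close>
  have "eventually A r \<longleftrightarrow> eventually A (r \<star> p)" for A
  proof -
    have "\<forall>\<^sub>F y in p. A (x @ y) \<longleftrightarrow> (\<forall>\<^sub>F y' in p. A (x @ y @ y'))" for x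
    proof (cases "\<forall>\<^sub>F y in p. A (x @ y)")
      case True
      then have "\<forall>\<^sub>F y in p. \<forall>\<^sub>F y' in p. A (x @ y @ y')"
        using eventually_concat_filter[of "\<lambda>y. A (x @ y)" p p] p(2) by simp
      with True show ?thesis by eventually_elim auto
    next
      case False
      then have F: "\<forall>\<^sub>F y in p. \<not> A (x @ y)" using ultra_not[OF p(1)] by simp
      then have "\<forall>\<^sub>F y in p. \<forall>\<^sub>F y' in p. \<not> A (x @ y @ y')"
        using eventually_concat_filter[of "\<lambda>y. \<not> A (x @ y)" p p] p(2) by simp
      with F show ?thesis
        by eventually_elim (use ultra_not[OF p(1)] in auto)
    qed
    then have "eventually (\<lambda>z. A z \<longleftrightarrow> (\<forall>\<^sub>F y in p. A (z @ y))) (G \<star> p)"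
      by (simp add: eventually_concat_filter)
    then have *: "\<forall>\<^sub>F z in r. A z \<longleftrightarrow> (\<forall>\<^sub>F y in p. A (z @ y))" using r(2) by (simp add: le_filter_def)
    show ?thesis unfolding eventually_concat_filter
      by (rule eventually_subst[OF *])
  qed
  then show ?thesis by (simp add: filter_eq_iff)
qed

definition instantiate :: "nat \<Rightarrow> nat \<Rightarrow> nat list \<Rightarrow> nat list" where
  "instantiate s a = map (\<lambda>c. if c = s then a else c)"

text \<open>Here the letters are the numbers below \<open>s\<close>, and \<open>s\<close> is the variable. The ultrafilter \<open>p\<close>
  is a minimal idempotent of words and \<open>q\<close> an idempotent of variable words below \<open>p\<close>; every
  instance of \<open>q\<close> is then an idempotent below \<open>p\<close>.\<close>

lemma variable_word_ultrafilter:
  obtains p q where "ultra p" "p \<star> p = p" "p \<le> principal (lists {..<s})"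
    "ultra q" "q \<le> principal {w \<in> lists {..s}. s \<in> set w}"
    "\<And>a. a < s \<Longrightarrow> filtermap (instantiate s a) q = p"
proof -
  define S where "S = principal (lists {..<s})"
  define M where "M = principal (lists {..s})"
  define V where "V = principal {w \<in> lists {..s}. s \<in> set w}"
  have SM: "S \<le> M" and VM: "V \<le> M" by (auto simp: S_def M_def V_def)
  have SS: "S \<star> S \<le> S" unfolding S_def by (rule concat_filter_principal_le) auto
  have MV: "M \<star> V \<le> V" unfolding M_def V_def by (rule concat_filter_principal_le) auto
  have S0: "S \<noteq> bot" by (auto simp: S_def principal_eq_bot_iff intro: exI[of _ "[]"])
  have V0: "V \<noteq> bot" by (auto simp: V_def principal_eq_bot_iff intro: exI[of _ "[s]"])
  \<comment> \<open>A minimal left ideal; by \<open>ideal\<close>, every proper filter below it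
    generates it.\<close>
  obtain I where I: "I \<le> S" "I \<noteq> bot" "S \<star> I \<le> I"
    and min: "\<And>F. F \<le> I \<Longrightarrow> F \<noteq> bot \<Longrightarrow> S \<star> F \<le> F \<Longrightarrow> F = I"
    using minimal_prefixed_filter[of "\<lambda>F. S \<star> F" S] SS S0
    by (auto simp: mono_def concat_filter_mono)
  have ideal: "S \<star> r = I" if "r \<le> I" "r \<noteq> bot" for r
  proof (rule min)
    show "S \<star> r \<le> I" using concat_filter_mono[OF order_refl that(1), of S] I(3) by simp
    show "S \<star> r \<noteq> bot" using S0 that by (simp add: concat_filter_eq_bot)
    show "S \<star> (S \<star> r) \<le> S \<star> r"
      using concat_filter_mono[OF SS order_refl, of r] by (simp add: concat_filter_assoc)
  qed
  have "I \<star> I \<le> I" using concat_filter_mono[OF I(1) order_refl, of I] I(3) by simp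
  then obtain p where p: "p \<le> I" "ultra p" "p \<star> p = p"
    using idempotent_ultra_exists I(2) by blast
  have pS: "p \<le> S" using p(1) I(1) by simp
  \<comment> \<open>The idempotent \<open>e\<close> of variable words is sought in this left ideal
    so that \<open>p\<close> is a right identity for it.\<close>
  have "(V \<star> p) \<star> (V \<star> p) \<le> V \<star> p"
  proof -
    have "M \<star> M \<le> M" unfolding M_def by (rule concat_filter_principal_le) auto
    then have "V \<star> p \<le> M" using concat_filter_mono[OF VM order_trans[OF pS SM]] by (rule order_trans[rotated])
    then have "V \<star> p \<star> V \<le> V"
      using concat_filter_mono[of "V \<star> p" M V V] MV by (blast intro: order_trans)
    then show ?thesis
      using concat_filter_mono[of "V \<star> p \<star> V" V p p] by (simp add: concat_filter_assoc)
  qed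
  moreover have "V \<star> p \<noteq> bot" using V0 p(2) by (simp add: concat_filter_eq_bot ultra_nonbot)
  ultimately obtain e where e: "e \<le> V \<star> p" "ultra e" "e \<star> e = e"
    using idempotent_ultra_exists by blast
  have ep: "e \<star> p = e" using idempotent_right_identity p e by blast
  \<comment> \<open>The factor \<open>p\<close> on the left makes \<open>p\<close> a left identity
    too, and \<open>e \<star> p = e\<close> keeps the product idempotent.\<close>
  define q where "q = p \<star> e"
  have q: "ultra q" using p e by (simp add: q_def ultra_concat)
  have qq: "q \<star> q = q" unfolding q_def by (metis concat_filter_assoc e(3) ep)
  have pq: "p \<star> q = q" unfolding q_def by (metis concat_filter_assoc p(3))
  have qp: "q \<star> p = q" unfolding q_def by (metis concat_filter_assoc ep)
  have qV: "q \<le> V"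
  proof -
    have "V \<star> S \<le> V" unfolding V_def S_def by (rule concat_filter_principal_le) auto
    then have "e \<le> V" using e(1) concat_filter_mono[OF order_refl pS, of V] by auto
    then show ?thesis
      using concat_filter_mono[OF order_trans[OF pS SM], of e V] MV
      unfolding q_def by (blast intro: order_trans)
  qed
  show thesis
  proof (rule that)
    fix a assume a: "a < s"
    let ?h = "instantiate s a"
    define r where "r = filtermap ?h q"
    have hom: "filtermap ?h (F \<star> G) = filtermap ?h F \<star> filtermap ?h G" for F G
      unfolding instantiate_def by (rule filtermap_concat_filter)
    have "?h w = w" if "w \<in> lists {..<s}" for w
      unfolding instantiate_def using that by (auto intro!: map_idI)
    moreover have "\<forall>\<^sub>F w in p. w \<in> lists {..<s}" using pS by (simp add: S_def le_principal)
    ultimately have fixed: "\<forall>\<^sub>F w in p. ?h w = w" by (auto elim!: eventually_mono)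
    then have hp: "filtermap ?h p = p"
      unfolding filter_eq_iff eventually_filtermap
      by (intro allI eventually_subst eventually_mono[OF fixed]) simp
    have r: "ultra r" "r \<star> r = r" "p \<star> r = r" "r \<star> p = r"
      using ultra_filtermap[OF q] hom[of q q] hom[of p q] hom[of q p]
      by (simp_all add: r_def qq pq qp hp)
    have "r \<le> S"
    proof -
      have "?h w \<in> lists {..<s}" if "w \<in> lists {..s}" for w
        using that a by (auto simp: instantiate_def order_less_le)
      then show ?thesis using qV unfolding r_def S_def V_def
        by (auto simp: le_principal eventually_filtermap elim!: eventually_mono)
    qed
    \<comment> \<open>Here minimality enters: \<open>r\<close> falls into \<open>I\<close> and
      generates it, so \<open>r\<close> is a right identity for \<open>p\<close>. As
      \<open>p\<close> is a left identity for \<open>r\<close>, both equal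
      \<open>p \<star> r\<close>.\<close>
    then have "r \<le> S \<star> p" using concat_filter_mono[of r S p p] r(4) by simp
    then have "r \<le> I" using ideal[OF p(1)] p(2) ultra_nonbot by auto
    then have "p \<le> S \<star> r" using ideal[of r] p(1) ultra_nonbot[OF r(1)] by simp
    then have "p \<star> r = p" using idempotent_right_identity r p by blast
    then show "filtermap ?h q = p" using r(3) by (simp add: r_def)
  qed (use p pS q qV in \<open>auto simp: S_def V_def\<close>)
qed

section \<open>Parameter words\<close>

text \<open>Over an alphabet of \<open>s\<close> letters, the number \<open>c < s\<close> is a letter and \<open>s + i\<close> is the parameter
  $\lambda_i$; thus $\lambda_0$ over \<open>s\<close> letters is the last letter over \<open>Suc s\<close> letters, and the
  other parameters keep their names. An infinite word \<open>W\<close> with infinitely many parameters is given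
  by its initial segments, \<open>W n\<close> being the part before the first occurrence of $\lambda_n$, so
  that \<open>apply_word\<close> needs no truncation.\<close>

definition subst_letter :: "nat \<Rightarrow> nat list \<Rightarrow> nat \<Rightarrow> nat" where
  "subst_letter s u c = (if c < s then c else u ! (c - s))"

definition omega_word :: "nat \<Rightarrow> (nat \<Rightarrow> nat list) \<Rightarrow> bool" where
  "omega_word s W \<longleftrightarrow>
     (\<forall>n. set (W n) \<subseteq> {..<s + n} \<and> prefix (W n @ [s + n]) (W (Suc n)))"

definition apply_word :: "nat \<Rightarrow> (nat \<Rightarrow> nat list) \<Rightarrow> nat list \<Rightarrow> nat list" where
  "apply_word s W u = map (subst_letter s u) (W (length u))"

fun param_words :: "nat \<Rightarrow> nat \<Rightarrow> nat list set" where
  "param_words s 0 = lists {..<s}"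
| "param_words s (Suc m) = {u @ s # E | u E. u \<in> lists {..<s} \<and> E \<in> param_words (Suc s) m}"

lemma omega_word_set: "omega_word s W \<Longrightarrow> c \<in> set (W n) \<Longrightarrow> c < s + n"
  by (auto simp: omega_word_def)

lemma omega_word_prefix_add:
  assumes "omega_word s W"
  shows "prefix (W n @ [s + n]) (W (Suc (n + d)))"
proof (induction d)
  case 0
  then show ?case using assms by (simp add: omega_word_def)
next
  case (Suc d)
  have "prefix (W (Suc (n + d))) (W (Suc (n + Suc d)))"
    using assms by (metis add_Suc_right append_prefixD omega_word_def)
  with Suc show ?case by (rule prefix_order.trans)
qed

lemma omega_word_prefix: "omega_word s W \<Longrightarrow> n < k \<Longrightarrow> prefix (W n @ [s + n]) (W k)"
  using omega_word_prefix_add[of s W n "k - Suc n"] by simp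

text \<open>The parameter with index \<open>length u\<close> first occurs right after
  \<open>W (length u)\<close>, and it is replaced by \<open>c\<close>.\<close>

lemma apply_word_Cons:
  assumes "omega_word s W"
  obtains r where "apply_word s W (u @ c # v) = apply_word s W u @ c # r"
proof -
  obtain z where z: "W (length (u @ c # v)) = W (length u) @ (s + length u) # z"
    using omega_word_prefix[OF assms, of "length u" "length (u @ c # v)"]
    by (auto elim!: prefixE)
  have "subst_letter s (u @ c # v) d = subst_letter s u d" if "d \<in> set (W (length u))" for d
    using omega_word_set[OF assms that] by (auto simp: subst_letter_def nth_append)
  then show thesis using that z by (auto simp: apply_word_def subst_letter_def)
qed

lemma apply_word_set:
  assumes "omega_word s W" "set u \<subseteq> {..<s + n}"
  shows "set (apply_word s W u) \<subseteq> {..<s + n}"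
proof -
  have "subst_letter s u c < s + n" if "c \<in> set (W (length u))" for c
  proof (cases "c < s")
    case False
    then have "u ! (c - s) \<in> set u" using omega_word_set[OF assms(1) that] by (intro nth_mem) simp
    then show ?thesis using assms(2) False by (auto simp: subst_letter_def)
  qed (simp add: subst_letter_def)
  then show ?thesis by (auto simp: apply_word_def)
qed

lemma apply_word_lists: "omega_word s W \<Longrightarrow> u \<in> lists {..<s} \<Longrightarrow> apply_word s W u \<in> lists {..<s}"
  using apply_word_set[of s W u 0] by (auto simp: lists_eq_set)

text \<open>Associativity of substitution, W(v)(u) = W(v(u)), in the case where \<open>u\<close>
  fills all parameters of \<open>v\<close> and nothing is cut off.\<close>

lemma map_subst_letter_apply_word:
  assumes "omega_word s W" "set v \<subseteq> {..<s + length u}"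
  shows "map (subst_letter s u) (apply_word s W v) = apply_word s W (map (subst_letter s u) v)"
proof -
  have "subst_letter s u (subst_letter s v c) = subst_letter s (map (subst_letter s u) v) c" if "c \<in> set (W (length v))" for c
    using omega_word_set[OF assms(1) that] by (auto simp: subst_letter_def)
  then show ?thesis by (auto simp: apply_word_def)
qed

definition compose :: "nat \<Rightarrow> (nat \<Rightarrow> nat list) \<Rightarrow> (nat \<Rightarrow> nat list) \<Rightarrow> nat \<Rightarrow> nat list" where
  "compose s W V n = apply_word s W (V n)"

lemma omega_word_compose:
  assumes W: "omega_word s W" and V: "omega_word s V"
  shows "omega_word s (compose s W V)"
  unfolding omega_word_def
proof (intro allI conjI)
  fix n
  show "set (compose s W V n) \<subseteq> {..<s + n}"
    unfolding compose_def using V by (intro apply_word_set[OF W]) (auto simp: omega_word_def)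
  obtain v where v: "V (Suc n) = V n @ (s + n) # v"
    using V by (auto simp: omega_word_def prefix_def)
  obtain r where "apply_word s W (V (Suc n)) = apply_word s W (V n) @ (s + n) # r"
    using apply_word_Cons[OF W] unfolding v by blast
  then show "prefix (compose s W V n @ [s + n]) (compose s W V (Suc n))"
    by (simp add: compose_def)
qed

lemma apply_word_compose:
  assumes "omega_word s W" "omega_word s V"
  shows "apply_word s (compose s W V) u = apply_word s W (apply_word s V u)"
  using map_subst_letter_apply_word[OF assms(1), of "V (length u)" u] assms(2)
  by (auto simp: compose_def apply_word_def[of s "compose s W V"] apply_word_def[of s V] omega_word_def)

text \<open>Once the part \<open>u\<close> before the first parameter is fixed, \<open>V\<close>
  acts on the rest like a word over one more letter. Inductions on the number of parameters can thus
  follow the recursion of \<open>param_words\<close>.\<close>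

lemma apply_word_tail:
  assumes V: "omega_word s V" and u: "u \<in> lists {..<s}"
  obtains V' where "omega_word (Suc s) V'"
    "\<And>E. apply_word s V (u @ s # E) = apply_word s V u @ s # apply_word (Suc s) V' E"
proof -
  define n where "n = length u"
  \<comment> \<open>Parameters filled by \<open>u\<close> become its letters; \<open>s + n\<close>,
    which receives the new letter \<open>s\<close>, becomes \<open>s\<close>; later parameters move
    down by \<open>n\<close>.\<close>
  define ren where "ren c = (if c < s then c else if c < s + n then u ! (c - s) else c - n)" for c
  define tl where "tl k = drop (Suc (length (V n))) (V (Suc (n + k)))" for k
  define V' where "V' k = map ren (tl k)" for k
  have tl: "V (Suc (n + k)) = V n @ (s + n) # tl k" for k
    using omega_word_prefix_add[OF V, of n k] by (auto simp: prefix_def tl_def)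
  have u_lt: "u ! i < s" if "i < n" for i using u that by (auto simp: n_def)
  have "omega_word (Suc s) V'"
    unfolding omega_word_def
  proof (intro allI conjI)
    fix k
    have "ren c < Suc s + k" if "c \<in> set (tl k)" for c
    proof -
      have "c < s + Suc (n + k)" using omega_word_set[OF V, of c "Suc (n + k)"] tl that by simp
      then show ?thesis
        using u_lt[of "c - s"] by (cases "c - s < n") (auto simp: ren_def intro: less_trans)
    qed
    then show "set (V' k) \<subseteq> {..<Suc s + k}" by (auto simp: V'_def)
    have "prefix (tl k @ [s + Suc (n + k)]) (tl (Suc k))"
      using V tl[of k] tl[of "Suc k"] unfolding omega_word_def
      by (metis add_Suc_right append.assoc append_Cons same_prefix_prefix Cons_prefix_Cons)
    then have "prefix (map ren (tl k @ [s + Suc (n + k)])) (V' (Suc k))"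
      unfolding V'_def by (rule map_mono_prefix)
    then show "prefix (V' k @ [Suc s + k]) (V' (Suc k))"
      by (simp add: V'_def ren_def)
  qed
  moreover have "apply_word s V (u @ s # E) = apply_word s V u @ s # apply_word (Suc s) V' E" for E
  proof -
    have "subst_letter s (u @ s # E) c = subst_letter s u c" if "c \<in> set (V n)" for c
      using omega_word_set[OF V that] by (auto simp: subst_letter_def nth_append n_def)
    moreover have "subst_letter s (u @ s # E) c = subst_letter (Suc s) E (ren c)" for c
      using u_lt[of "c - s"]
      by (auto simp: subst_letter_def nth_append nth_Cons' ren_def n_def add.commute)
    ultimately show ?thesis
      using tl[of "length E"]
      by (auto simp: apply_word_def V'_def n_def subst_letter_def)
  qed
  ultimately show thesis using that by blast
qed

lemma apply_word_param_words:
  assumes "omega_word s V" "E \<in> param_words s m"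
  shows "apply_word s V E \<in> param_words s m"
  using assms
proof (induction m arbitrary: s V E)
  case 0
  then show ?case using apply_word_lists by simp
next
  case (Suc m)
  then obtain u F where E: "E = u @ s # F" "u \<in> lists {..<s}" "F \<in> param_words (Suc s) m" by auto
  obtain V' where "omega_word (Suc s) V'" "apply_word s V E = apply_word s V u @ s # apply_word (Suc s) V' F"
    using apply_word_tail[OF Suc.prems(1) E(2)] E(1) by metis
  then show ?case using Suc.IH[of "Suc s" V' F] E apply_word_lists[OF Suc.prems(1) E(2)] by auto
qed

lemma subst_letter_snoc:
  assumes "z \<in> lists {..<s + length u}"
  shows "map (subst_letter s (u @ [a])) z = map (subst_letter s u) z"
  using assms by (auto simp: subst_letter_def nth_append)

text \<open>The words \<open>z n\<close> are the concatenations of the first \<open>n\<close> variable words chosen; \<open>W n\<close>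
  ends just before the variable of the next one.\<close>

lemma omega_word_monochromatic_words:
  fixes \<chi> :: "nat list \<Rightarrow> 'c"
  assumes "finite (range \<chi>)"
  obtains W c where "omega_word s W" "\<And>u. u \<in> lists {..<s} \<Longrightarrow> \<chi> (apply_word s W u) = c"
proof -
  obtain p q where p: "ultra p" "p \<star> p = p" "p \<le> principal (lists {..<s})"
    and q: "ultra q" "q \<le> principal {w \<in> lists {..s}. s \<in> set w}"
    and inst: "\<And>a. a < s \<Longrightarrow> filtermap (instantiate s a) q = p"
    by (rule variable_word_ultrafilter[of s]) (rule that)
  let ?pre = "takeWhile (\<lambda>c. c < s)"
  \<comment> \<open>The distribution of the part of a variable word before its variable; the colour
    is stabilised on words of \<open>p\<close> followed by such a part.\<close>
  define t where "t = filtermap ?pre q"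
  have "ultra (p \<star> t)" unfolding t_def using p q ultra_concat ultra_filtermap by blast
  then obtain c where c: "\<forall>\<^sub>F x in p \<star> t. \<chi> x = c" using ultra_finite_range assms by blast
  define B where "B w \<longleftrightarrow> (\<forall>\<^sub>F v in q. \<chi> (w @ ?pre v) = c)" for w
  have B: "eventually B p"
    using c by (simp add: B_def[abs_def] t_def eventually_concat_filter eventually_filtermap)
  \<comment> \<open>The device of Galvin and Glazer: as \<open>p\<close> is idempotent,
    \<open>B'\<close> is inherited by \<open>p\<close>-most extensions, so the construction never
    gets stuck.\<close>
  define B' where "B' w \<longleftrightarrow> B w \<and> (\<forall>\<^sub>F v in p. B (w @ v))" for w
  have B': "eventually B' p"
    using B eventually_concat_filter[of B p p] p(2)
    by (simp add: B'_def[abs_def] eventually_conj_iff)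
  have B'_step: "\<forall>\<^sub>F v in p. B' (w @ v)" if "B' w" for w
  proof -
    have "\<forall>\<^sub>F v in p. B (w @ v)" using that by (simp add: B'_def)
    moreover from this have "\<forall>\<^sub>F v in p. \<forall>\<^sub>F v' in p. B (w @ v @ v')"
      using eventually_concat_filter[of "\<lambda>v. B (w @ v)" p p] p(2) by simp
    ultimately show ?thesis by (simp add: B'_def eventually_conj_iff)
  qed
  define good where
    "good n z \<longleftrightarrow> z \<in> lists {..<s + n} \<and> (\<forall>u\<in>lists {..<s}. length u = n \<longrightarrow> B' (map (subst_letter s u) z))"
    for n z
  define next_word where "next_word n z z' v \<longleftrightarrow>
      z' = z @ map (\<lambda>c. if c = s then s + n else c) v \<and> s \<in> set v \<and> v \<in> lists {..s} \<and>
      (\<forall>u\<in>lists {..<s}. length u = n \<longrightarrow> \<chi> (map (subst_letter s u) z @ ?pre v) = c)" for n z z' v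
  have "\<exists>z. \<forall>n. good n (z n) \<and> (\<exists>v. next_word n (z n) (z (Suc n)) v)"
  proof (rule dependent_nat_choice)
    have "\<forall>\<^sub>F w in p. B' w \<and> w \<in> lists {..<s}"
      using B' p(3) by (simp add: eventually_conj_iff le_principal)
    then obtain w where "B' w" "w \<in> lists {..<s}"
      using ultra_nonbot[OF p(1)] eventually_happens' by blast
    moreover from this have "map (subst_letter s []) w = w" by (auto simp: subst_letter_def intro!: map_idI)
    ultimately show "\<exists>z. good 0 z" by (auto simp: good_def)
  next
    fix z n assume z: "good n z"
    \<comment> \<open>Only finitely many words of length \<open>n\<close> constrain the next choice.
      Each instance of \<open>q\<close> is \<open>p\<close>, so one variable word serves all of them
      and all letters \<open>a\<close> at once.\<close>
    define U where "U = {u \<in> lists {..<s}. length u = n}"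
    have finU: "finite U"
      unfolding U_def using finite_lists_length_eq[of "{..<s}" n] by (simp add: lists_eq_set)
    have "\<forall>\<^sub>F v in q. \<chi> (map (subst_letter s u) z @ ?pre v) = c \<and>
        (\<forall>a<s. B' (map (subst_letter s u) z @ instantiate s a v))" if "u \<in> U" for u
    proof -
      have Bu: "B' (map (subst_letter s u) z)" using z that by (simp add: good_def U_def)
      have "\<forall>\<^sub>F v in q. B' (map (subst_letter s u) z @ instantiate s a v)" if "a < s" for a
        using B'_step[OF Bu] unfolding inst[OF that, symmetric] eventually_filtermap .
      then have "\<forall>\<^sub>F v in q. \<forall>a\<in>{..<s}. B' (map (subst_letter s u) z @ instantiate s a v)"
        by (intro eventually_ball_finite) auto
      moreover have "\<forall>\<^sub>F v in q. \<chi> (map (subst_letter s u) z @ ?pre v) = c"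
        using Bu by (simp add: B'_def B_def)
      ultimately show ?thesis by eventually_elim auto
    qed
    then have "\<forall>\<^sub>F v in q. \<forall>u\<in>U. \<chi> (map (subst_letter s u) z @ ?pre v) = c \<and>
        (\<forall>a<s. B' (map (subst_letter s u) z @ instantiate s a v))"
      by (intro eventually_ball_finite finU) auto
    moreover have "\<forall>\<^sub>F v in q. v \<in> lists {..s} \<and> s \<in> set v"
      using q(2) by (simp add: le_principal)
    ultimately have "\<forall>\<^sub>F v in q. (\<forall>u\<in>U. \<chi> (map (subst_letter s u) z @ ?pre v) = c \<and>
        (\<forall>a<s. B' (map (subst_letter s u) z @ instantiate s a v))) \<and> v \<in> lists {..s} \<and> s \<in> set v"
      by (rule eventually_conj)
    then obtain v where v: "\<And>u. u \<in> U \<Longrightarrow> \<chi> (map (subst_letter s u) z @ ?pre v) = c"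
      "\<And>u a. u \<in> U \<Longrightarrow> a < s \<Longrightarrow> B' (map (subst_letter s u) z @ instantiate s a v)"
      "v \<in> lists {..s}" "s \<in> set v"
      using ultra_nonbot[OF q(1)] eventually_happens' by blast
    define z' where "z' = z @ map (\<lambda>c. if c = s then s + n else c) v"
    have "good (Suc n) z'"
      unfolding good_def
    proof (intro conjI ballI impI)
      show "z' \<in> lists {..<s + Suc n}"
        using z v(3) by (auto simp: z'_def good_def lists_eq_set)
      fix u' assume u': "u' \<in> lists {..<s}" "length u' = Suc n"
      then obtain u a where ua: "u' = u @ [a]" by (metis length_Suc_conv_rev)
      have "map (subst_letter s u') z = map (subst_letter s u) z"
        unfolding ua using z u' ua by (intro subst_letter_snoc) (auto simp: good_def)
      moreover have "map (subst_letter s u') (map (\<lambda>c. if c = s then s + n else c) v) = instantiate s a v"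
        using v(3) u' ua by (auto simp: instantiate_def subst_letter_def lists_eq_set)
      moreover have "B' (map (subst_letter s u) z @ instantiate s a v)"
        using u' ua by (intro v(2)) (auto simp: U_def)
      ultimately show "B' (map (subst_letter s u') z')" unfolding z'_def map_append by (simp only:)
    qed
    moreover have "next_word n z z' v" using v by (auto simp: next_word_def z'_def U_def)
    ultimately show "\<exists>z'. good (Suc n) z' \<and> (\<exists>v. next_word n z z' v)" by blast
  qed
  then obtain z where z: "\<And>n. good n (z n)" and "\<forall>n. \<exists>v. next_word n (z n) (z (Suc n)) v"
    by blast
  then obtain v where v: "\<And>n. next_word n (z n) (z (Suc n)) (v n)" by metis
  define W where "W n = z n @ ?pre (v n)" for n
  have "omega_word s W"
    unfolding omega_word_def
  proof (intro allI conjI)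
    fix n
    show "set (W n) \<subseteq> {..<s + n}"
      using z[of n] by (auto simp: W_def good_def lists_eq_set dest!: set_takeWhileD)
    have "s \<in> set (v n)" "v n \<in> lists {..s}" using v[of n] by (auto simp: next_word_def)
    \<comment> \<open>\<open>v n\<close> has no letter above \<open>s\<close>, so the initial run of
      letters is ended by the variable.\<close>
    then obtain r where "v n = ?pre (v n) @ s # r"
    proof -
      have "dropWhile (\<lambda>c. c < s) (v n) \<noteq> []"
        using \<open>s \<in> set (v n)\<close> by (auto simp: dropWhile_eq_Nil_conv)
      moreover from this have "hd (dropWhile (\<lambda>c. c < s) (v n)) = s"
        using hd_dropWhile[of "\<lambda>c. c < s" "v n"] \<open>v n \<in> lists {..s}\<close>
          set_dropWhileD[of "hd (dropWhile (\<lambda>c. c < s) (v n))" "\<lambda>c. c < s" "v n"]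
        by (auto simp: lists_eq_set)
      ultimately show thesis
        using that[of "List.tl (dropWhile (\<lambda>c. c < s) (v n))"]
        by (metis list.collapse takeWhile_dropWhile_id)
    qed
    then have "z (Suc n) = z n @ map (\<lambda>c. if c = s then s + n else c) (?pre (v n) @ s # r)"
      using v[of n] by (auto simp: next_word_def)
    also have "map (\<lambda>c. if c = s then s + n else c) (?pre (v n)) = ?pre (v n)"
      by (auto intro!: map_idI dest!: set_takeWhileD)
    then have "z n @ map (\<lambda>c. if c = s then s + n else c) (?pre (v n) @ s # r)
        = (W n @ [s + n]) @ map (\<lambda>c. if c = s then s + n else c) r"
      by (simp add: W_def)
    finally show "prefix (W n @ [s + n]) (W (Suc n))"
      by (auto simp: W_def)
  qed
  moreover have "\<chi> (apply_word s W u) = c" if "u \<in> lists {..<s}" for u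
  proof -
    have "map (subst_letter s u) (?pre w) = ?pre w" for w
      by (auto simp: subst_letter_def dest!: set_takeWhileD intro!: map_idI)
    then show ?thesis using v[of "length u"] that by (simp add: apply_word_def W_def next_word_def)
  qed
  ultimately show thesis using that by blast
qed

section \<open>The Carlson-Simpson theorem\<close>

text \<open>\<open>[s..<s + j]\<close> lists the first \<open>j\<close> parameters with no letters
  between them; composing with such a \<open>V\<close> leaves \<open>W 0\<close> to
  \<open>W i\<close> unchanged.\<close>

definition fixes_upto :: "nat \<Rightarrow> nat \<Rightarrow> (nat \<Rightarrow> nat list) \<Rightarrow> bool" where
  "fixes_upto s i V \<longleftrightarrow> (\<forall>j\<le>i. V j = [s..<s + j])"

lemma apply_word_fixed:
  assumes "fixes_upto s i V" "length u \<le> i"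
  shows "apply_word s V u = u"
  using assms by (auto simp: fixes_upto_def apply_word_def subst_letter_def intro: nth_equalityI)

lemma apply_word_upt:
  assumes "omega_word s V"
  shows "apply_word s V [s..<s + n] = V n"
proof -
  have "subst_letter s [s..<s + n] c = c" if "c \<in> set (V n)" for c
    using omega_word_set[OF assms that] by (auto simp: subst_letter_def)
  then show ?thesis by (auto simp: apply_word_def intro: map_idI)
qed

text \<open>The intermediate goal for \<open>Suc m\<close> parameters: the colour may still depend
  on the part \<open>u\<close> before the first parameter, but no longer on the tail.\<close>

definition tail_constant ::
    "nat \<Rightarrow> nat \<Rightarrow> (nat list \<Rightarrow> 'c) \<Rightarrow> (nat \<Rightarrow> nat list) \<Rightarrow> nat list \<Rightarrow> bool" where
  "tail_constant s m \<chi> W u \<longleftrightarrow>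
     (\<forall>E\<in>param_words (Suc s) m. \<forall>E'\<in>param_words (Suc s) m.
        \<chi> (apply_word s W (u @ s # E)) = \<chi> (apply_word s W (u @ s # E')))"

lemma tail_constantD:
  "tail_constant s m \<chi> W u \<Longrightarrow> E \<in> param_words (Suc s) m \<Longrightarrow> E' \<in> param_words (Suc s) m \<Longrightarrow>
    \<chi> (apply_word s W (u @ s # E)) = \<chi> (apply_word s W (u @ s # E'))"
  unfolding tail_constant_def by blast

lemma tail_constant_compose:
  assumes "tail_constant s m \<chi> W u" "u \<in> lists {..<s}"
    "omega_word s W" "omega_word s V" "fixes_upto s i V" "length u \<le> i"
  shows "tail_constant s m \<chi> (compose s W V) u"
proof -
  obtain V' where V': "omega_word (Suc s) V'"
    "\<And>E. apply_word s V (u @ s # E) = apply_word s V u @ s # apply_word (Suc s) V' E"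
    by (rule apply_word_tail[OF assms(4,2)]) (rule that)
  have "apply_word s (compose s W V) (u @ s # E) = apply_word s W (u @ s # apply_word (Suc s) V' E)" for E
    by (simp add: apply_word_compose[OF assms(3,4)] apply_word_fixed[OF assms(5,6)] V'(2))
  then show ?thesis
    unfolding tail_constant_def
    by (simp only:) (intro ballI tail_constantD[OF assms(1)] apply_word_param_words[OF V'(1)])
qed

section \<open>The induction step from \<open>m\<close> to \<open>Suc m\<close> parameters\<close>

context
  fixes s m :: nat and \<chi> :: "nat list \<Rightarrow> 'c"
  assumes fin: "finite (range \<chi>)"
    and tails: "\<And>\<chi>' :: nat list \<Rightarrow> 'c. finite (range \<chi>') \<Longrightarrow>
      \<exists>V. omega_word (Suc s) V \<and> (\<forall>E\<in>param_words (Suc s) m. \<forall>E'\<in>param_words (Suc s) m.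
        \<chi>' (apply_word (Suc s) V E) = \<chi>' (apply_word (Suc s) V E'))"
begin

text \<open>The hypothesis \<open>tails\<close> is applied to the colouring of the tails behind
  \<open>u\<close>, and the resulting word is put behind the parameters that absorb \<open>u\<close>
  and the letter \<open>s\<close>.\<close>

lemma tail_constant_single:
  assumes W: "omega_word s W" and u: "u \<in> lists {..<s}"
  obtains V where "omega_word s V" "fixes_upto s (length u) V"
    "tail_constant s m \<chi> (compose s W V) u"
proof -
  define i where "i = length u"
  have "finite (range (\<lambda>E. \<chi> (apply_word s W (u @ s # E))))"
    using fin by (rule finite_subset[rotated]) auto
  then obtain V' where V': "omega_word (Suc s) V'"
    and mono: "\<And>E E'. E \<in> param_words (Suc s) m \<Longrightarrow> E' \<in> param_words (Suc s) m \<Longrightarrow>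
      \<chi> (apply_word s W (u @ s # apply_word (Suc s) V' E)) = \<chi> (apply_word s W (u @ s # apply_word (Suc s) V' E'))"
    using tails by blast
  \<comment> \<open>The shift opposite to that of \<open>apply_word_tail\<close>: the letter
    \<open>s\<close> of the larger alphabet becomes the parameter with index \<open>i\<close>, the
    first one not filled by \<open>u\<close>.\<close>
  define ren where "ren c = (if c < s then c else c + i)" for c
  define V where
    "V j = (if j \<le> i then [s..<s + j] else [s..<Suc (s + i)] @ map ren (V' (j - Suc i)))" for j
  have V_Suc: "V (Suc (i + k)) = [s..<Suc (s + i)] @ map ren (V' k)" for k
    by (simp add: V_def)
  have "omega_word s V"
    unfolding omega_word_def
  proof (intro allI conjI)
    fix n
    consider "n < i" | "n = i" | k where "n = Suc (i + k)"
      by (metis less_imp_Suc_add linorder_neqE_nat)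
    then show "set (V n) \<subseteq> {..<s + n}"
    proof cases
      case 3
      have "ren c < s + n" if "c \<in> set (V' k)" for c
        using omega_word_set[OF V' that] 3 by (auto simp: ren_def)
      then show ?thesis using 3 V_Suc[of k] by auto
    qed (auto simp: V_def)
    consider "n < i" | "n = i" | k where "n = Suc (i + k)"
      by (metis less_imp_Suc_add linorder_neqE_nat)
    then show "prefix (V n @ [s + n]) (V (Suc n))"
    proof cases
      case 3
      have "prefix (map ren (V' k @ [Suc s + k])) (map ren (V' (Suc k)))"
        using V' by (intro map_mono_prefix) (simp add: omega_word_def)
      then show ?thesis using 3 V_Suc[of k] V_Suc[of "Suc k"] by (simp add: ren_def add.commute add.left_commute)
    qed (auto simp: V_def)
  qed
  moreover have "fixes_upto s i V" by (simp add: fixes_upto_def V_def)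
  moreover have "apply_word s V (u @ s # E) = u @ s # apply_word (Suc s) V' E" for E
  proof -
    have "map (subst_letter s (u @ s # E)) [s..<Suc (s + i)] = u @ [s]"
      by (rule nth_equalityI) (auto simp: subst_letter_def i_def nth_append nth_Cons' less_Suc_eq simp del: upt_Suc)
    moreover have "subst_letter s (u @ s # E) (ren c) = subst_letter (Suc s) E c" for c
      by (auto simp: subst_letter_def ren_def i_def nth_append nth_Cons' add.commute)
    ultimately show ?thesis
      using V_Suc[of "length E"] by (auto simp: apply_word_def i_def simp del: upt_Suc)
  qed
  then have "apply_word s (compose s W V) (u @ s # E) = apply_word s W (u @ s # apply_word (Suc s) V' E)" for E
    by (simp add: apply_word_compose[OF W \<open>omega_word s V\<close>])
  then have "tail_constant s m \<chi> (compose s W V) u"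
    unfolding tail_constant_def by (simp only:) (intro ballI mono)
  ultimately show thesis using that by (simp add: i_def)
qed

lemma tail_constant_set:
  assumes "omega_word s W" "finite F" "F \<subseteq> {u \<in> lists {..<s}. length u = i}"
  shows "\<exists>V. omega_word s V \<and> fixes_upto s i V \<and> (\<forall>u\<in>F. tail_constant s m \<chi> (compose s W V) u)"
  using assms(2,3)
proof (induction F rule: finite_induct)
  case empty
  have "omega_word s (\<lambda>n. [s..<s + n])" by (auto simp: omega_word_def)
  then show ?case by (auto simp: fixes_upto_def)
next
  case (insert u F)
  then obtain V where V: "omega_word s V" "fixes_upto s i V"
    "\<forall>u\<in>F. tail_constant s m \<chi> (compose s W V) u" by auto
  have u: "u \<in> lists {..<s}" "length u = i" using insert.prems by auto
  have WV: "omega_word s (compose s W V)" using assms(1) V(1) by (rule omega_word_compose)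
  obtain V2 where V2: "omega_word s V2" "fixes_upto s i V2"
    "tail_constant s m \<chi> (compose s (compose s W V) V2) u"
    using tail_constant_single[OF WV u(1)] u(2) by metis
  have "compose s (compose s W V) V2 = compose s W (compose s V V2)"
    using assms(1) V(1) by (simp add: fun_eq_iff compose_def[of s _ V2] apply_word_compose compose_def[of s W "compose s V V2"])
  moreover have "fixes_upto s i (compose s V V2)"
    using V(2) V2(2) apply_word_upt[OF V(1)] by (simp add: fixes_upto_def compose_def)
  moreover have "tail_constant s m \<chi> (compose s (compose s W V) V2) w" if "w \<in> F" for w
    using V(3) that insert.prems by (intro tail_constant_compose[OF _ _ WV V2(1,2)]) auto
  ultimately show ?case
    using V2(3) omega_word_compose[OF V(1) V2(1)] by (intro exI[of _ "compose s V V2"]) auto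
qed

text \<open>Fusion: the \<open>n\<close>-th step is correct for the words of length \<open>n\<close> and does not change the
  first \<open>n\<close> parameters, so that the diagonal word is correct for all words.\<close>

lemma tail_constant_all:
  obtains W where "omega_word s W" "\<And>u. u \<in> lists {..<s} \<Longrightarrow> tail_constant s m \<chi> W u"
proof -
  define good where "good n W \<longleftrightarrow> omega_word s W \<and>
    (\<forall>u\<in>lists {..<s}. length u < n \<longrightarrow> tail_constant s m \<chi> W u)" for n W
  have "\<exists>W. \<forall>n. good n (W n) \<and> (\<forall>j\<le>n. W (Suc n) j = W n j)"
  proof (rule dependent_nat_choice)
    have "omega_word s (\<lambda>n. [s..<s + n])" by (auto simp: omega_word_def)
    then show "\<exists>W. good 0 W" by (auto simp: good_def)
  next
    fix W n assume good: "good n W"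
    then have W: "omega_word s W" by (simp add: good_def)
    have "finite {u \<in> lists {..<s}. length u = n}"
      using finite_lists_length_eq[of "{..<s}" n] by (simp add: lists_eq_set)
    from tail_constant_set[OF W this order_refl] obtain V where V: "omega_word s V" "fixes_upto s n V"
      "\<And>u. u \<in> lists {..<s} \<Longrightarrow> length u = n \<Longrightarrow> tail_constant s m \<chi> (compose s W V) u"
      by blast
    have "tail_constant s m \<chi> (compose s W V) u" if "u \<in> lists {..<s}" "length u < n" for u
      using good that by (intro tail_constant_compose[OF _ _ W V(1,2)]) (auto simp: good_def)
    then have "good (Suc n) (compose s W V)"
      using V(3) omega_word_compose[OF W V(1)] by (auto simp: good_def less_Suc_eq)
    moreover have "\<forall>j\<le>n. compose s W V j = W j"
      using V(2) apply_word_upt[OF W] by (simp add: compose_def fixes_upto_def)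
    ultimately show "\<exists>W'. good (Suc n) W' \<and> (\<forall>j\<le>n. W' j = W j)" by blast
  qed
  then obtain W where good: "\<And>n. good n (W n)" and step: "\<And>n j. j \<le> n \<Longrightarrow> W (Suc n) j = W n j"
    by blast
  have agree: "W (j + d) j = W j j" for j d
    by (induction d) (auto simp: step)
  define W' where "W' n = W n n" for n
  have app_W': "apply_word s W' u = apply_word s (W n) u" if "length u \<le> n" for u n
    using agree[of "length u" "n - length u"] that by (simp add: apply_word_def W'_def)
  have "omega_word s W'"
    unfolding omega_word_def
  proof
    fix n
    show "set (W' n) \<subseteq> {..<s + n} \<and> prefix (W' n @ [s + n]) (W' (Suc n))"
      using good[of n] good[of "Suc n"] step[of n n]
      by (metis good_def omega_word_def order_refl W'_def)
  qed
  moreover have "tail_constant s m \<chi> W' u" if "u \<in> lists {..<s}" for u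
    unfolding tail_constant_def
  proof (intro ballI)
    fix E E' assume E: "E \<in> param_words (Suc s) m" "E' \<in> param_words (Suc s) m"
    define n where "n = Suc (length u + length E + length E')"
    have "tail_constant s m \<chi> (W n) u" using good[of n] that by (simp add: good_def n_def)
    then have "\<chi> (apply_word s (W n) (u @ s # E)) = \<chi> (apply_word s (W n) (u @ s # E'))"
      using E by (rule tail_constantD)
    then show "\<chi> (apply_word s W' (u @ s # E)) = \<chi> (apply_word s W' (u @ s # E'))"
      using app_W'[of _ n] by (simp add: n_def)
  qed
  ultimately show thesis using that by blast
qed

end

lemma omega_word_monochromatic:
  fixes \<chi> :: "nat list \<Rightarrow> 'c"
  assumes "finite (range \<chi>)"
  shows "\<exists>W. omega_word s W \<and>
    (\<forall>E\<in>param_words s m. \<forall>E'\<in>param_words s m. \<chi> (apply_word s W E) = \<chi> (apply_word s W E'))"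
  using assms
proof (induction m arbitrary: s \<chi>)
  case 0
  obtain W c where "omega_word s W" "\<And>u. u \<in> lists {..<s} \<Longrightarrow> \<chi> (apply_word s W u) = c"
    using omega_word_monochromatic_words[OF 0] by metis
  then show ?case by (metis param_words.simps(1))
next
  case (Suc m)
  obtain W where W: "omega_word s W" "\<And>u. u \<in> lists {..<s} \<Longrightarrow> tail_constant s m \<chi> W u"
    using tail_constant_all[where s = s and m = m, OF Suc.prems Suc.IH] by metis
  \<comment> \<open>Since tails no longer affect the colour, one fixed tail reduces it to a
    colouring of the words \<open>u\<close>, which the case without parameters settles.\<close>
  define F where "F = (SOME E. E \<in> param_words (Suc s) m)"
  have "finite (range (\<lambda>u. \<chi> (apply_word s W (u @ s # F))))"
    using Suc.prems by (rule finite_subset[rotated]) auto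
  then obtain V c where V: "omega_word s V"
    and c: "\<And>u. u \<in> lists {..<s} \<Longrightarrow> \<chi> (apply_word s W (apply_word s V u @ s # F)) = c"
    using omega_word_monochromatic_words[of "\<lambda>u. \<chi> (apply_word s W (u @ s # F))" s] by metis
  have "\<chi> (apply_word s (compose s W V) E) = c" if Em: "E \<in> param_words s (Suc m)" for E
  proof -
    obtain u E' where E: "E = u @ s # E'" "u \<in> lists {..<s}" "E' \<in> param_words (Suc s) m"
      using Em unfolding param_words.simps by blast
    obtain V' where V': "omega_word (Suc s) V'" "apply_word s V E = apply_word s V u @ s # apply_word (Suc s) V' E'"
      using apply_word_tail[OF V E(2)] E(1) by metis
    have "F \<in> param_words (Suc s) m" unfolding F_def using E(3) by (rule someI)
    then have "\<chi> (apply_word s W (apply_word s V u @ s # apply_word (Suc s) V' E')) = \<chi> (apply_word s W (apply_word s V u @ s # F))"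
      by (rule tail_constantD[OF W(2)[OF apply_word_lists[OF V E(2)]] apply_word_param_words[OF V'(1) E(3)]])
    then show ?thesis using V'(2) c[OF E(2)] W(1) V by (simp add: apply_word_compose)
  qed
  then show ?case using omega_word_compose[OF W(1) V] by metis
qed

text \<open>One composition for each number of parameters; earlier constancy survives because
  \<open>V\<close> preserves that number. The colour may vary with \<open>m\<close>.\<close>

lemma omega_word_monochromatic_le:
  fixes \<chi> :: "nat list \<Rightarrow> 'c"
  assumes "finite (range \<chi>)"
  shows "\<exists>W. omega_word s W \<and>
    (\<forall>m\<le>M. \<forall>E\<in>param_words s m. \<forall>E'\<in>param_words s m. \<chi> (apply_word s W E) = \<chi> (apply_word s W E'))"
proof (induction M)
  case 0
  then show ?case using omega_word_monochromatic[OF assms, of s 0] by auto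
next
  case (Suc M)
  then obtain W where W: "omega_word s W"
    "\<forall>m\<le>M. \<forall>E\<in>param_words s m. \<forall>E'\<in>param_words s m. \<chi> (apply_word s W E) = \<chi> (apply_word s W E')" by auto
  have "finite (range (\<lambda>E. \<chi> (apply_word s W E)))"
    using assms by (rule finite_subset[rotated]) auto
  then obtain V where V: "omega_word s V" "\<forall>E\<in>param_words s (Suc M). \<forall>E'\<in>param_words s (Suc M).
      \<chi> (apply_word s W (apply_word s V E)) = \<chi> (apply_word s W (apply_word s V E'))"
    using omega_word_monochromatic[of "\<lambda>E. \<chi> (apply_word s W E)" s "Suc M"] by blast
  have "\<chi> (apply_word s (compose s W V) E) = \<chi> (apply_word s (compose s W V) E')"
    if "m \<le> Suc M" "E \<in> param_words s m" "E' \<in> param_words s m" for m E E'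
  proof (cases "m = Suc M")
    case True
    then show ?thesis using V that unfolding apply_word_compose[OF W(1) V(1)] by blast
  next
    case False
    then have "m \<le> M" using that by simp
    then show ?thesis
      using W(2) apply_word_param_words[OF V(1) that(2)] apply_word_param_words[OF V(1) that(3)]
      unfolding apply_word_compose[OF W(1) V(1)] by blast
  qed
  then show ?case using omega_word_compose[OF W(1) V(1)] by blast
qed

section \<open>Envelopes\<close>

text \<open>The cut comes before the first parameter of index at least \<open>length t\<close>; in a
  parameter word this is the one of index \<open>length t\<close>.\<close>

definition subst_finite :: "nat \<Rightarrow> nat list \<Rightarrow> nat list \<Rightarrow> nat list" where
  "subst_finite s E t = map (subst_letter s t) (takeWhile (\<lambda>c. c < s + length t) E)"

text \<open>Symbols before the cut have images below the bound, and by
  \<open>apply_word_Cons\<close> the first symbol cut off from \<open>E\<close> reappears right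
  behind them.\<close>

lemma subst_finite_apply_word:
  assumes "omega_word s W"
  shows "subst_finite s (apply_word s W E) t = apply_word s W (subst_finite s E t)"
proof -
  let ?P = "\<lambda>c. c < s + length t"
  define A where "A = takeWhile ?P E"
  have A: "set A \<subseteq> {..<s + length t}" by (auto simp: A_def dest: set_takeWhileD)
  have all: "set (apply_word s W A) \<subseteq> {..<s + length t}" by (rule apply_word_set[OF assms A])
  have "takeWhile ?P (apply_word s W E) = apply_word s W A"
  proof (cases "dropWhile ?P E")
    case Nil
    then have "A = E" using takeWhile_dropWhile_id[of ?P E] by (simp add: A_def)
    then show ?thesis using all by (simp add: takeWhile_eq_all_conv subset_iff)
  next
    case (Cons c r)
    then have E: "E = A @ c # r" using takeWhile_dropWhile_id[of ?P E] by (simp add: A_def)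
    have c: "\<not> ?P c" using hd_dropWhile[of ?P E] Cons by simp
    obtain r' where "apply_word s W E = apply_word s W A @ c # r'"
      unfolding E by (rule apply_word_Cons[OF assms])
    then show ?thesis using c all by (auto simp: takeWhile_append)
  qed
  then show ?thesis using map_subst_letter_apply_word[OF assms A] by (simp add: subst_finite_def A_def)
qed

text \<open>Passes from the description by first occurrences to the recursive one by splitting
  \<open>E\<close> at its first \<open>s\<close>.\<close>

lemma param_wordsI:
  assumes "set E \<subseteq> {..<s + m}" "\<And>j. j < m \<Longrightarrow> s + j \<in> set E"
    "\<And>j. j < m \<Longrightarrow> set (takeWhile (\<lambda>c. c \<noteq> s + j) E) \<subseteq> {..<s + j}"
  shows "E \<in> param_words s m"
  using assms
proof (induction m arbitrary: s E)
  case 0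
  then show ?case by auto
next
  case (Suc m)
  define u where "u = takeWhile (\<lambda>c. c \<noteq> s) E"
  have u: "set u \<subseteq> {..<s}" using Suc.prems(3)[of 0] by (simp add: u_def)
  have "s \<in> set E" using Suc.prems(2)[of 0] by simp
  then have "dropWhile (\<lambda>c. c \<noteq> s) E \<noteq> []" by (auto simp: dropWhile_eq_Nil_conv)
  then obtain c r where cr: "dropWhile (\<lambda>c. c \<noteq> s) E = c # r" by (meson list.exhaust)
  then have "c = s" using hd_dropWhile[of "\<lambda>c. c \<noteq> s" E] by simp
  then have E: "E = u @ s # r" using cr takeWhile_dropWhile_id[of "\<lambda>c. c \<noteq> s" E] by (simp add: u_def)
  have "r \<in> param_words (Suc s) m"
  proof (rule Suc.IH)
    show "set r \<subseteq> {..<Suc s + m}" using Suc.prems(1) E by auto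
    fix j assume j: "j < m"
    show "Suc s + j \<in> set r" using Suc.prems(2)[of "Suc j"] j u by (auto simp: E)
    have "takeWhile (\<lambda>c. c \<noteq> s + Suc j) E = u @ s # takeWhile (\<lambda>c. c \<noteq> s + Suc j) r"
      using u unfolding E by (subst takeWhile_append2) auto
    then show "set (takeWhile (\<lambda>c. c \<noteq> Suc s + j) r) \<subseteq> {..<Suc s + j}"
      using Suc.prems(3)[of "Suc j"] j by simp
  qed
  then show ?case using E u by (auto simp: lists_eq_set)
qed

lemma param_word_unique:
  assumes "param_word n W" "param_word n' W"
  shows "n = n'"
proof -
  have lt: "enat i < n \<longleftrightarrow> enat i < n'" for i
    using assms unfolding param_word_def by blast
  have "\<not> n < n'" using lt by (cases n) auto
  moreover have "\<not> n' < n" using lt by (cases n') auto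
  ultimately show ?thesis by simp
qed

lemma first_occ_less:
  assumes W: "param_word n W" and "i < j" "enat j < n"
  shows "first_occ (Par i) W < first_occ (Par j) W"
proof -
  have "occurs (Par j) W" using assms by (simp add: param_word_def)
  \<comment> \<open>Only the length \<open>j\<close> of this dummy word matters: it makes
    \<open>W\<close> stop at the parameter with index \<open>j\<close>.\<close>
  then have "stop_at W (Fin (replicate j undefined)) = enat (first_occ (Par j) W)"
    by (simp add: stop_at_def)
  then show ?thesis
    using first_occ_less_stop_at[OF W, of i "Fin (replicate j undefined)"] assms by simp
qed

lemma first_occ_le: "enat p < slen W \<Longrightarrow> letter_at W p = c \<Longrightarrow> first_occ c W \<le> p"
  unfolding first_occ_def by (rule Least_le) simp

lemma slen_word_of [simp]: "slen (word_of w) = enat (length w)"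
  by (simp add: word_of_def)

lemma letter_at_word_of [simp]: "j < length w \<Longrightarrow> letter_at (word_of w) j = Ltr (w ! j)"
  by (simp add: word_of_def)

lemma stop_at_le_slen: "stop_at W U \<le> slen W"
  by (auto simp: stop_at_def first_occ_props(1) less_imp_le split: enat.split)

lemma param_below_stop_at:
  assumes W: "param_word n W" and U: "slen U = enat m" "enat m \<le> n"
    and p: "enat p < stop_at W U" "letter_at W p = Par i"
  shows "i < m"
proof (rule ccontr)
  assume "\<not> i < m"
  have pW: "enat p < slen W" using p(1) stop_at_le_slen by (rule less_le_trans)
  then have "occurs (Par i) W" using p(2) by (auto simp: occurs_def)
  then have i: "enat i < n" using W by (simp add: param_word_def)
  then have "enat m < n" using \<open>\<not> i < m\<close> by (meson enat_ord_simps(1) le_less_trans not_less)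
  then have "stop_at W U = enat (first_occ (Par m) W)"
    using W U by (simp add: stop_at_def param_word_def)
  moreover have "first_occ (Par m) W \<le> first_occ (Par i) W"
    using first_occ_less[OF W _ i, of m] \<open>\<not> i < m\<close> by (cases "m = i") auto
  moreover have "first_occ (Par i) W \<le> p" using first_occ_le[OF pW p(2)] .
  ultimately show False using p(1) by simp
qed

text \<open>Numbers the values of \<open>g\<close> by first appearance. Used as parameter indices,
  such numbers satisfy the order condition on first occurrences.\<close>

lemma enumerate_by_first_occurrence:
  fixes g :: "nat \<Rightarrow> 'b"
  shows "\<exists>r. inj_on r (g ` {..<N}) \<and> (\<forall>j\<le>N. \<exists>c. (\<lambda>i. r (g i)) ` {..<j} = {..<c :: nat})"
proof (induction N)
  case 0
  then show ?case by (auto intro: exI[of _ 0])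
next
  case (Suc N)
  then obtain r where r: "inj_on r (g ` {..<N})"
    "\<And>j. j \<le> N \<Longrightarrow> \<exists>c. (\<lambda>i. r (g i)) ` {..<j} = {..<c :: nat}" by blast
  show ?case
  proof (cases "g N \<in> g ` {..<N}")
    case True
    then have eq: "g ` {..<Suc N} = g ` {..<N}" by (auto simp: lessThan_Suc)
    then have "(\<lambda>i. r (g i)) ` {..<Suc N} = (\<lambda>i. r (g i)) ` {..<N}"
      by (metis image_image)
    then have "\<exists>c. (\<lambda>i. r (g i)) ` {..<j} = {..<c}" if "j \<le> Suc N" for j
      using r(2)[of j] r(2)[of N] that by (cases "j = Suc N") auto
    then show ?thesis using r(1) eq by auto
  next
    case False
    obtain n where n: "(\<lambda>i. r (g i)) ` {..<N} = {..<n}" using r(2) by blast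
    define r' where "r' = r(g N := n)"
    have r': "r' (g i) = r (g i)" if "i < N" for i
      using False that unfolding r'_def by (metis fun_upd_other imageI lessThan_iff)
    have old: "(\<lambda>i. r' (g i)) ` {..<j} = (\<lambda>i. r (g i)) ` {..<j}" if "j \<le> N" for j
      using that r' by (intro image_cong) auto
    have "(\<lambda>i. r' (g i)) ` {..<Suc N} = {..<Suc n}"
      using old[of N] n by (simp add: lessThan_Suc r'_def)
    then have "\<exists>c. (\<lambda>i. r' (g i)) ` {..<j} = {..<c}" if "j \<le> Suc N" for j
      using old[of j] r(2)[of j] that by (cases "j = Suc N") auto
    moreover have "inj_on r' (g ` {..<Suc N})"
    proof -
      have "inj_on r' (g ` {..<N})" using r(1) r' by (auto simp: inj_on_def)
      moreover have "r' (g N) \<notin> r' ` g ` {..<N}"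
      proof -
        have "r' ` g ` {..<N} = {..<n}" using old[of N] n by (simp add: image_image)
        then show ?thesis by (simp add: r'_def)
      qed
      ultimately show ?thesis using False by (simp add: lessThan_Suc)
    qed
    ultimately show ?thesis by blast
  qed
qed

text \<open>In this envelope each parameter stands for the indices at which the words of \<open>S\<close> have one
  and the same column of letters, where a word that has already ended contributes \<open>None\<close>. A word
  ends at an index with a new column, as it should.\<close>

lemma bounded_envelope:
  fixes S :: "'a list set"
  assumes "finite S" "S \<noteq> {}" "finite (UNIV :: 'a set)"
  shows "\<exists>W n. envelope W (word_of ` S) \<and> param_word (enat n) W \<and>
    n \<le> card {xs :: 'a option list. length xs = card S}"
proof -
  obtain ws where ws: "set ws = S" "distinct ws" using finite_distinct_list[OF assms(1)] by blast
  define col where "col j = map (\<lambda>w. if j < length w then Some (w ! j) else None) ws" for j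
  define N where "N = Max (length ` S)"
  have len: "length w \<le> N" if "w \<in> S" for w using that assms(1) by (auto simp: N_def)
  have col_eq: "(if i < length w then Some (w ! i) else None) = (if j < length w then Some (w ! j) else None)"
    if "col i = col j" "w \<in> S" for i j w
    using that ws(1) by (auto simp: col_def)
  obtain r where inj: "inj_on r (col ` {..<N})"
    and r: "\<And>j. j \<le> N \<Longrightarrow> \<exists>c. (\<lambda>i. r (col i)) ` {..<j} = {..<c :: nat}"
    using enumerate_by_first_occurrence[of col N] by blast
  define a where "a i = r (col i)" for i
  have a: "\<exists>c. a ` {..<j} = {..<c}" if "j \<le> N" for j
    using r[OF that] by (simp add: a_def[abs_def])
  have a_inj: "col i = col j" if "a i = a j" "i < N" "j < N" for i j
    using inj that by (auto simp: a_def inj_on_def)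
  obtain n where n: "a ` {..<N} = {..<n}" using a by blast
  define W where "W = Fin (map (\<lambda>j. Par (a j) :: 'a sym) [0..<N])"
  have W_slen: "slen W = enat N" and W_at: "\<And>j. j < N \<Longrightarrow> letter_at W j = Par (a j)"
    by (auto simp: W_def)
  have occ: "occurs (Par i) W \<longleftrightarrow> i < n" for i
  proof -
    have "occurs (Par i) W \<longleftrightarrow> i \<in> a ` {..<N}" using W_at by (auto simp: occurs_def W_slen)
    then show ?thesis using n by simp
  qed
  have W: "param_word (enat n) W"
    unfolding param_word_def
  proof (intro conjI allI impI)
    fix i assume i: "1 \<le> i \<and> enat i < enat n"
    define p where "p = first_occ (Par i) W"
    have "occurs (Par i) W" using i occ by simp
    from first_occ_props[OF this] have p: "p < N" "a p = i" using W_slen W_at by (auto simp: p_def)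
    obtain c where c: "a ` {..<Suc p} = {..<c}" using a[of "Suc p"] p(1) by auto
    then have "i \<in> {..<c}" using p(2) by blast
    then have "i - 1 \<in> {..<c}" by simp
    then obtain q where q: "q < Suc p" "a q = i - 1" unfolding c[symmetric] by auto
    then have "q < p" using p(2) i by (cases "q = p") auto
    then show "first_occ (Par (i - 1)) W < first_occ (Par i) W"
      using first_occ_le[of q W "Par (i - 1)"] W_slen W_at[of q] q(2) p by (simp add: p_def)
  qed (simp add: occ)
  have "\<exists>U'. substitutable W U' \<and> subst W U' = word_of w" if w: "w \<in> S" for w
  proof -
    define l where "l = length w"
    have l: "l \<le> N" using len[OF w] by (simp add: l_def)
    obtain c where c: "a ` {..<l} = {..<c}" using a[OF l] by blast
    define U where "U = word_of (map (\<lambda>i. w ! (LEAST p. a p = i)) [0..<c])"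
    have U_slen: "slen U = enat c" by (simp add: U_def)
    have "{..<c} \<subseteq> {..<n}" unfolding c[symmetric] n[symmetric] using l by auto
    then have "c \<le> n" by simp
    have "param_word 0 U" by (auto simp: param_word_def occurs_def U_def zero_enat_def[symmetric])
    then have "substitutable W U"
      unfolding substitutable_def using W U_slen \<open>c \<le> n\<close> by (metis enat_ord_simps(1))
    moreover have stop: "stop_at W U = enat l"
    proof (cases "l < N")
      case True
      \<comment> \<open>The entry of \<open>w\<close> in column \<open>l\<close> is
        \<open>None\<close>, while all earlier columns have a letter there.\<close>
      have new: "a i \<noteq> a l" if "i < l" for i
        using a_inj[of i l] col_eq[of i l w] w that True by (auto simp: l_def)
      obtain c' where c': "a ` {..<Suc l} = {..<c'}" using a[of "Suc l"] True by auto
      then have "insert (a l) {..<c} = {..<c'}" using c by (simp add: lessThan_Suc)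
      moreover have "a l \<notin> {..<c}" using new unfolding c[symmetric] by force
      ultimately have "a l = c"
        by (metis insertI1 insert_iff lessThan_iff less_trans linorder_neqE_nat less_irrefl)
      have "first_occ (Par c) W = l"
        unfolding first_occ_def
      proof (rule Least_equality)
        show "enat l < slen W \<and> letter_at W l = Par c" using True W_slen W_at \<open>a l = c\<close> by simp
        fix y assume "enat y < slen W \<and> letter_at W y = Par c"
        then have "a y = a l" using W_slen W_at[of y] \<open>a l = c\<close> by simp
        then show "l \<le> y" using new[of y] by (meson not_le)
      qed
      moreover have "occurs (Par c) W"
        using True W_slen W_at \<open>a l = c\<close> by (auto simp: occurs_def)
      ultimately show ?thesis by (simp add: stop_at_def U_slen)
    next
      case False
      then have "c = n" using l c n by (simp add: lessThan_eq_iff)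
      then show ?thesis using False l occ[of n] by (simp add: stop_at_def U_slen W_slen)
    qed
    moreover have "subst W U = word_of w"
    proof (rule fistring_eqI)
      show "slen (subst W U) = slen (word_of w)" by (simp add: slen_subst stop l_def)
      fix j assume "enat j < slen (subst W U)"
      then have j: "j < l" by (simp add: slen_subst stop)
      define p where "p = (LEAST p. a p = a j)"
      have p: "a p = a j" "p \<le> j"
        unfolding p_def
        using LeastI[of "\<lambda>p. a p = a j" j] Least_le[of "\<lambda>p. a p = a j" j] by simp_all
      have "col p = col j" using p j l by (intro a_inj) auto
      from col_eq[OF this w] have "w ! p = w ! j" using j p(2) by (simp add: l_def)
      moreover have "a j < c" using c j by blast
      moreover have "letter_at (subst W U) j = subst_sym U (Par (a j))"
        using letter_at_subst[of j W U] W_at[of j] j l stop by simp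
      ultimately show "letter_at (subst W U) j = letter_at (word_of w) j"
        using j by (simp add: U_def p_def l_def)
    qed
    ultimately show ?thesis by blast
  qed
  then have "envelope W (word_of ` S)" using W unfolding envelope_def by blast
  moreover have "n \<le> card {xs :: 'a option list. length xs = card S}"
  proof -
    have "{..<n} = r ` col ` {..<N}" using n by (simp add: a_def[abs_def] image_image)
    then have "n = card (col ` {..<N})" using inj by (metis card_image card_lessThan)
    also have "\<dots> \<le> card {xs :: 'a option list. length xs = card S}"
    proof (rule card_mono)
      have "finite (UNIV :: 'a option set)" using assms(3) by (simp add: finite_option_UNIV)
      then show "finite {xs :: 'a option list. length xs = card S}"
        using finite_lists_length_eq[of "UNIV :: 'a option set" "card S"] by simp
      show "col ` {..<N} \<subseteq> {xs. length xs = card S}"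
        using ws distinct_card by (fastforce simp: col_def)
    qed
    finally show ?thesis .
  qed
  ultimately show ?thesis using W by blast
qed

lemma minimal_envelope_exists:
  assumes "envelope W0 S"
  shows "\<exists>W. minimal_envelope W S"
proof -
  define P where "P n \<longleftrightarrow> (\<exists>W. envelope W S \<and> param_word n W)" for n
  have "\<exists>n. P n" using assms unfolding P_def envelope_def by blast
  then have "P (LEAST n. P n)" by (rule LeastI_ex)
  then obtain W where W: "envelope W S" "param_word (LEAST n. P n) W" unfolding P_def by blast
  have "n \<le> n'" if "envelope W' S" "param_word n W" "param_word n' W'" for W' n n'
  proof -
    have "n = (LEAST n. P n)" using param_word_unique that(2) W(2) by blast
    moreover have "P n'" using that unfolding P_def by blast
    ultimately show ?thesis by (simp add: Least_le)
  qed
  then show ?thesis using W(1) unfolding minimal_envelope_def by blast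
qed

fun decode :: "nat \<Rightarrow> letter" where
  "decode 0 = L" | "decode (Suc 0) = X" | "decode (Suc (Suc n)) = R"

lemma decode_rank [simp]: "decode (letter_rank a) = a"
  by (cases a) (simp_all add: eval_nat_numeral)

lemma letter_rank_less [simp]: "letter_rank a < 3"
  by (cases a) simp_all

lemma map_letter_rank_lists: "map letter_rank w \<in> lists {..<3}"
  by (auto simp: lists_eq_set)

text \<open>A minimal envelope can be infinite, or have more parameters than the words in \<open>tau S\<close> have
  letters; here it is cut off at the end of its longest instance in \<open>S\<close>.\<close>

lemma tau_representation:
  fixes S :: "letter list set"
  assumes S: "finite S" "S \<noteq> {}"
  defines "T \<equiv> {map letter_rank u | u. word_of u \<in> tau S}"
  shows "T \<subseteq> {t \<in> lists {..<3}. length t \<le> card {xs :: letter option list. length xs = card S}}"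
    and "T \<noteq> {}"
    and "\<exists>E\<in>param_words 3 (Max (length ` T)). map letter_rank ` S = subst_finite 3 E ` T"
proof -
  define M where "M = card {xs :: letter option list. length xs = card S}"
  have "finite (UNIV :: letter set)"
  proof (rule finite_subset)
    show "UNIV \<subseteq> {L, X, R}" using letter.exhaust by blast
  qed simp
  then obtain W1 n1 where W1: "envelope W1 (word_of ` S)" "param_word (enat n1) W1" "n1 \<le> M"
    using bounded_envelope[OF S] unfolding M_def by blast
  define W where "W = (SOME W. minimal_envelope W (word_of ` S))"
  have "minimal_envelope W (word_of ` S)"
    unfolding W_def using minimal_envelope_exists[OF W1(1)] by (rule someI_ex)
  then have env: "envelope W (word_of ` S)"
    and min: "\<And>n. param_word n W \<Longrightarrow> n \<le> enat n1"
    using W1 unfolding minimal_envelope_def by blast+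
  obtain n' where n': "param_word n' W" using env unfolding envelope_def by blast
  obtain n where "n' = enat n" using min[OF n'] by (cases n') auto
  then have W: "param_word (enat n) W" and "n \<le> M" using n' min[OF n'] W1(3) by auto
  have tau: "\<forall>U\<in>tau S. substitutable W U" "subst W ` tau S = word_of ` S"
    using theI'[OF tau_env_unique[OF env]] unfolding tau_def W_def[symmetric] tau_env_def by blast+
  have slen_tau: "slen U \<le> enat n" if "U \<in> tau S" for U
    using tau(1) that param_word_unique[OF W] unfolding substitutable_def by metis
  have first_occ: "enat (first_occ (Par i) W) < stop_at W U" "letter_at W (first_occ (Par i) W) = Par i"
    if "U \<in> tau S" "enat i < slen U" for U i
  proof -
    show "enat (first_occ (Par i) W) < stop_at W U"
      by (rule first_occ_less_stop_at[OF W that(2) slen_tau[OF that(1)]])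
    have "enat i < enat n" using that slen_tau by (meson less_le_trans)
    then have "occurs (Par i) W" using W unfolding param_word_def by blast
    then show "letter_at W (first_occ (Par i) W) = Par i" by (rule first_occ_props(2))
  qed
  \<comment> \<open>Every symbol of \<open>U\<close> reappears in \<open>subst W U\<close>, at the
    first occurrence of its parameter, and that instance consists of letters.\<close>
  have word: "\<exists>u. U = word_of u" if U: "U \<in> tau S" for U
  proof -
    obtain us where us: "U = Fin us" using slen_tau[OF U] by (cases U) auto
    obtain w where w: "subst W U = word_of w" using tau(2) U by blast
    have "\<exists>a. us ! i = Ltr a" if i: "i < length us" for i
    proof -
      let ?j = "first_occ (Par i) W"
      have j: "enat ?j < stop_at W U" "letter_at W ?j = Par i"
        using first_occ[OF U, of i] i us by auto
      then have "letter_at (word_of w) ?j = us ! i"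
        using letter_at_subst[OF j(1)] w us by simp
      moreover have "?j < length w" using j(1) w by (simp flip: slen_subst)
      ultimately have "us ! i = Ltr (w ! ?j)" by simp
      then show ?thesis ..
    qed
    then obtain b where "\<And>i. i < length us \<Longrightarrow> us ! i = Ltr (b i)" by metis
    then have "us = map Ltr (map b [0..<length us])" by (intro nth_equalityI) auto
    then show ?thesis unfolding us word_of_def by blast
  qed
  have len_le: "length u \<le> n" if "word_of u \<in> tau S" for u
    using slen_tau[OF that] by simp
  show bound: "T \<subseteq> {t \<in> lists {..<3}. length t \<le> card {xs :: letter option list. length xs = card S}}"
    using len_le \<open>n \<le> M\<close> map_letter_rank_lists unfolding T_def M_def[symmetric] by fastforce
  have "tau S \<noteq> {}" using tau(2) S(2) by auto
  then show "T \<noteq> {}" using word unfolding T_def by blast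
  define m where "m = Max (length ` T)"
  have "finite T"
    using bound finite_lists_length_le[of "{..<3::nat}"] finite_subset
    by (metis (no_types, lifting) Collect_cong finite_lessThan lists_eq_set mem_Collect_eq)
  have le_m: "length u \<le> m" if "word_of u \<in> tau S" for u
  proof -
    have "length (map letter_rank u) \<in> length ` T" using that unfolding T_def by blast
    then show ?thesis using \<open>finite T\<close> unfolding m_def by simp
  qed
  have "m \<in> length ` T" unfolding m_def using \<open>finite T\<close> \<open>T \<noteq> {}\<close> by simp
  \<comment> \<open>A longest word of \<open>tau S\<close>; cutting \<open>W\<close> at the end of
    its instance leaves exactly the parameters of index below \<open>m\<close>.\<close>
  then obtain u0 where u0: "word_of u0 \<in> tau S" "length u0 = m" unfolding T_def by auto
  then have "m \<le> n" using len_le by blast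
  obtain w0 where w0: "subst W (word_of u0) = word_of w0" using tau(2) u0(1) by blast
  define l where "l = length w0"
  have stop0: "stop_at W (word_of u0) = enat l" using slen_subst[of W "word_of u0"] w0 by (simp add: l_def)
  have l_slen: "enat l \<le> slen W" using stop_at_le_slen stop0 by metis
  define code where "code c = (case c of Ltr b \<Rightarrow> letter_rank b | Par i \<Rightarrow> 3 + i)" for c
  define E where "E = map (\<lambda>p. code (letter_at W p)) [0..<l]"
  have E_at: "length E = l" "\<And>p. p < l \<Longrightarrow> E ! p = code (letter_at W p)" by (auto simp: E_def)
  have below: "code (letter_at W p) < 3 + length u"
    if "word_of u \<in> tau S" "enat p < stop_at W (word_of u)" for u p
  proof (cases "letter_at W p")
    case (Par i)
    then show ?thesis
      using param_below_stop_at[OF W _ _ that(2) Par, of "length u"] len_le[OF that(1)] by (simp add: code_def)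
  qed (simp add: code_def trans_less_add1)
  have "E \<in> param_words 3 m"
  proof (rule param_wordsI)
    show "set E \<subseteq> {..<3 + m}" using below[OF u0(1)] u0(2) stop0 by (auto simp: E_def)
    fix j assume j: "j < m"
    let ?p = "first_occ (Par j) W"
    have p: "?p < l" "letter_at W ?p = Par j" using first_occ[OF u0(1), of j] u0(2) j stop0 by auto
    then have Ep: "E ! ?p = 3 + j" using E_at by (simp add: code_def)
    then show "3 + j \<in> set E" using p(1) E_at(1) nth_mem by metis
    show "set (takeWhile (\<lambda>c. c \<noteq> 3 + j) E) \<subseteq> {..<3 + j}"
    proof
      fix c assume "c \<in> set (takeWhile (\<lambda>c. c \<noteq> 3 + j) E)"
      then obtain q where q: "q < length (takeWhile (\<lambda>c. c \<noteq> 3 + j) E)"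
        "takeWhile (\<lambda>c. c \<noteq> 3 + j) E ! q = c" by (auto simp: in_set_conv_nth)
      have "E ! i \<noteq> 3 + j" if "i \<le> q" for i
      proof -
        have "i < length (takeWhile (\<lambda>c. c \<noteq> 3 + j) E)" using q(1) that by simp
        from nth_mem[OF this] show ?thesis using takeWhile_nth[OF \<open>i < _\<close>] set_takeWhileD by metis
      qed
      then have "q < ?p" using Ep by (meson not_less)
      then have ql: "q < l" "E ! q = c" using p(1) q takeWhile_nth[OF q(1)] by auto
      have "enat q < enat l" using ql by simp
      then have qW: "enat q < slen W" using l_slen by (rule less_le_trans)
      show "c \<in> {..<3 + j}"
      proof (cases "letter_at W q")
        case (Ltr b)
        then show ?thesis using ql E_at(2)[of q] letter_rank_less[of b] by (simp add: code_def)
      next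
        case (Par i)
        then have i_le: "first_occ (Par i) W \<le> q" using first_occ_le[OF qW] by simp
        have "occurs (Par i) W" using Par qW by (auto simp: occurs_def)
        then have "enat i < enat n" using W unfolding param_word_def by blast
        then have "i \<le> j"
          using first_occ_less[OF W, of j i] i_le \<open>q < ?p\<close> by (meson leI le_less_trans less_asym)
        moreover have "i \<noteq> j" using i_le \<open>q < ?p\<close> by auto
        ultimately show ?thesis using ql E_at(2)[of q] Par by (simp add: code_def)
      qed
    qed
  qed
  moreover have inst: "subst_finite 3 E (map letter_rank u) = map letter_rank w"
    if u: "word_of u \<in> tau S" and w: "subst W (word_of u) = word_of w" for u w
  proof -
    have stop: "stop_at W (word_of u) = enat (length w)"
      using slen_subst[of W "word_of u"] w by simp
    \<comment> \<open>The cut loses no truncation point: for \<open>u\<close> shorter than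
      \<open>m\<close>, the instance ends at a parameter still present in \<open>E\<close>;
      otherwise it ends where \<open>E\<close> does.\<close>
    have end_letter: "length w \<le> l \<and> (length w < l \<longrightarrow> letter_at W (length w) = Par (length u))"
    proof (cases "length u = m")
      case True
      then have "stop_at W (word_of u) = stop_at W (word_of u0)" using u0(2) by (simp add: stop_at_def)
      then show ?thesis using stop stop0 by simp
    next
      case False
      then have "length u < m" using le_m[OF u] by simp
      then have "first_occ (Par (length u)) W < l" "letter_at W (first_occ (Par (length u)) W) = Par (length u)"
        using first_occ[OF u0(1), of "length u"] u0(2) stop0 by auto
      moreover have "occurs (Par (length u)) W"
        using W \<open>length u < m\<close> \<open>m \<le> n\<close> by (simp add: param_word_def)
      then have "first_occ (Par (length u)) W = length w" using stop by (simp add: stop_at_def)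
      ultimately show ?thesis by simp
    qed
    have "takeWhile (\<lambda>c. c < 3 + length u) E = take (length w) E"
    proof (rule takeWhile_eq_take_P_nth)
      fix p assume "p < length w" "p < length E"
      then show "E ! p < 3 + length u" using below[OF u, of p] stop E_at by simp
    next
      assume "length w < length E"
      then show "\<not> E ! length w < 3 + length u" using end_letter E_at by (simp add: code_def)
    qed
    moreover have "map (subst_letter 3 (map letter_rank u)) (take (length w) E) = map letter_rank w"
    proof (rule nth_equalityI)
      fix p assume "p < length (map (subst_letter 3 (map letter_rank u)) (take (length w) E))"
      then have p: "p < length w" "p < l" using E_at by auto
      have eq: "Ltr (w ! p) = subst_sym (word_of u) (letter_at W p)"
        using letter_at_subst[of p W "word_of u"] p(1) stop w by simp
      have "subst_letter 3 (map letter_rank u) (code (letter_at W p)) = letter_rank (w ! p)"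
      proof (cases "letter_at W p")
        case (Ltr b)
        then show ?thesis using eq by (simp add: code_def subst_letter_def)
      next
        case (Par i)
        have "i < length u" using below[OF u, of p] stop p(1) Par by (simp add: code_def)
        then show ?thesis using eq Par by (simp add: code_def subst_letter_def)
      qed
      then show "map (subst_letter 3 (map letter_rank u)) (take (length w) E) ! p = map letter_rank w ! p"
        using p E_at by simp
    qed (use end_letter E_at in simp)
    ultimately show ?thesis by (simp add: subst_finite_def)
  qed
  have "map letter_rank ` S = subst_finite 3 E ` T"
  proof (intro equalityI subsetI)
    fix x assume "x \<in> map letter_rank ` S"
    then obtain w where w: "w \<in> S" "x = map letter_rank w" by blast
    then obtain U where U: "U \<in> tau S" "subst W U = word_of w" using tau(2) by (metis imageE image_eqI)
    then obtain u where "U = word_of u" using word by blast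
    then show "x \<in> subst_finite 3 E ` T" using inst[of u w] U w unfolding T_def by force
  next
    fix x assume "x \<in> subst_finite 3 E ` T"
    then obtain u where u: "word_of u \<in> tau S" "x = subst_finite 3 E (map letter_rank u)"
      unfolding T_def by blast
    then obtain w where "w \<in> S" "subst W (word_of u) = word_of w" using tau(2) by blast
    then show "x \<in> map letter_rank ` S" using inst u by simp
  qed
  ultimately show "\<exists>E\<in>param_words 3 (Max (length ` T)). map letter_rank ` S = subst_finite 3 E ` T"
    unfolding m_def by blast
qed

section \<open>The embedding\<close>

definition word_map :: "(nat \<Rightarrow> nat list) \<Rightarrow> letter list \<Rightarrow> letter list" where
  "word_map W w = map decode (apply_word 3 W (map letter_rank w))"

context
  fixes W :: "nat \<Rightarrow> nat list"
  assumes W: "omega_word 3 W"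
begin

lemma omega_word_nth: "n \<le> k \<Longrightarrow> p < length (W n) \<Longrightarrow> W k ! p = W n ! p"
  using omega_word_prefix[OF W, of n k] by (cases "n = k") (auto elim!: prefixE simp: nth_append)

lemma omega_word_param: "n < k \<Longrightarrow> length (W n) < length (W k) \<and> W k ! length (W n) = 3 + n"
  using omega_word_prefix[OF W, of n k] by (auto elim!: prefixE simp: nth_append)

lemma length_word_map: "length (word_map W w) = length (W (length w))"
  by (simp add: word_map_def apply_word_def)

lemma word_map_nth:
  assumes "p < length (W n)" "n \<le> length w"
  shows "word_map W w ! p =
    (if W n ! p < 3 then decode (W n ! p) else w ! (W n ! p - 3))"
    and "W n ! p < 3 + n" and "p < length (W (length w))"
proof -
  show *: "p < length (W (length w))"
    using assms omega_word_param[of n "length w"] by (cases "n = length w") auto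
  show "W n ! p < 3 + n" using omega_word_set[OF W nth_mem[OF assms(1)]] .
  then show "word_map W w ! p = (if W n ! p < 3 then decode (W n ! p) else w ! (W n ! p - 3))"
    using * assms(2) omega_word_nth[OF assms(2,1)]
    by (simp add: word_map_def apply_word_def subst_letter_def)
qed

lemma word_map_param:
  assumes "i < length w"
  shows "word_map W w ! length (W i) = w ! i" "length (W i) < length (word_map W w)"
proof -
  have i: "length (W i) < length (W (Suc i))" "W (Suc i) ! length (W i) = 3 + i"
    using omega_word_param[of i "Suc i"] by auto
  show "word_map W w ! length (W i) = w ! i"
    using word_map_nth(1)[OF i(1)] i(2) assms by simp
  show "length (W i) < length (word_map W w)"
    using word_map_nth(3)[OF i(1)] assms by (simp add: length_word_map)
qed

lemma inj_word_map: "inj (word_map W)"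
proof (rule injI)
  fix v w assume eq: "word_map W v = word_map W w"
  have "length v = length w"
  proof (rule linorder_cases)
    assume "length v < length w"
    then show ?thesis using omega_word_param[of "length v" "length w"] eq length_word_map by (metis less_irrefl)
  next
    assume "length w < length v"
    then show ?thesis using omega_word_param[of "length w" "length v"] eq length_word_map by (metis less_irrefl)
  qed
  then show "v = w" using eq word_map_param(1) by (metis nth_equalityI)
qed

text \<open>Within their common length, images differ only at parameters of \<open>W\<close>. First
  occurrences carry a comparison forward. Conversely, all parameters of index below \<open>i\<close>
  have occurred before any occurrence of parameter \<open>i\<close>, so the comparisons of earlier
  letters can be read back.\<close>

lemma order_embedding_word_map: "order_embedding (word_map W)"
  unfolding order_embedding_def
proof (intro conjI allI iffI inj_word_map)
  fix v w assume "v \<preceq> w"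
  then consider "v = w" | i where "i < length v" "i < length w" "v ! i = L" "w ! i = R" "\<And>j. j < i \<Longrightarrow> v ! j \<le> w ! j"
    unfolding preceq_def by auto
  then show "word_map W v \<preceq> word_map W w"
  proof cases
    case 1
    then show ?thesis by (simp add: preceq_def)
  next
    case 2
    have "word_map W v ! p \<le> word_map W w ! p" if "p < length (W i)" for p
      using word_map_nth[OF that, of v] word_map_nth[OF that, of w] 2 by simp
    then show ?thesis
      using 2 word_map_param[OF 2(1)] word_map_param[OF 2(2)] unfolding preceq_def
      by (intro disjI2 exI[of _ "length (W i)"]) simp
  qed
next
  fix v w assume "word_map W v \<preceq> word_map W w"
  then consider "word_map W v = word_map W w" | p where
    "p < length (word_map W v)" "p < length (word_map W w)"
    "word_map W v ! p = L" "word_map W w ! p = R"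
    "\<And>j. j < p \<Longrightarrow> word_map W v ! j \<le> word_map W w ! j"
    unfolding preceq_def by auto
  then show "v \<preceq> w"
  proof cases
    case 1
    then have "v = w" using inj_word_map by (simp add: inj_eq)
    then show ?thesis by (simp add: preceq_def)
  next
    case 2
    define n where "n = min (length v) (length w)"
    have n: "n \<le> length v" "n \<le> length w" by (auto simp: n_def)
    have p: "p < length (W n)" using 2(1,2) by (auto simp: n_def length_word_map min_def)
    note v = word_map_nth[OF p n(1)] and w = word_map_nth[OF p n(2)]
    have "\<not> W n ! p < 3" using v(1) w(1) 2(3,4) by auto
    then obtain i where i: "W n ! p = 3 + i" "i < n" using v(2) by (metis add.commute le_add_diff_inverse nat_add_left_cancel_less not_less)
    have "length (W i) \<le> p"
    proof (rule ccontr)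
      assume "\<not> length (W i) \<le> p"
      then have "W i ! p = 3 + i" using omega_word_nth[of i n p] i by simp
      then show False using \<open>\<not> length (W i) \<le> p\<close> omega_word_set[OF W nth_mem[of p "W i"]] by simp
    qed
    moreover have "length (W j) < length (W i)" if "j < i" for j using omega_word_param[OF that] by simp
    ultimately have "v ! j \<le> w ! j" if "j < i" for j
      using that 2(5)[of "length (W j)"] word_map_param(1)[of j v] word_map_param(1)[of j w] i(2) n
      by (metis (no_types) less_le_trans less_trans)
    then show ?thesis
      using v(1) w(1) i n 2(3,4) unfolding preceq_def by (intro disjI2 exI[of _ i]) auto
  qed
qed

end

theorem theorem4p10:
  fixes k :: nat and \<chi> :: "letter list set \<Rightarrow> 'c"
  assumes "k \<ge> 1"
    and "finite (\<chi> ` {A. finite A \<and> card A = k})"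
  shows "\<exists>f. order_embedding f \<and>
    (\<forall>A A'. A \<subseteq> range f \<and> A' \<subseteq> range f \<and>
       finite A \<and> card A = k \<and> finite A' \<and> card A' = k \<and>
       tau (f -` A) = tau (f -` A') \<longrightarrow> \<chi> A = \<chi> A')"
proof -
  define M where "M = card {xs :: letter option list. length xs = k}"
  define \<T> where "\<T> = Pow {t \<in> lists {..<3::nat}. length t \<le> M}"
  \<comment> \<open>\<open>\<chi>\<close> is known to take finitely many values only on sets of
    \<open>k\<close> words; a dummy colour elsewhere makes the range finite. Likewise, the
    restriction in \<open>col\<close> puts its values into a finite space of extensional
    functions.\<close>
  define \<chi>' where "\<chi>' A = (if finite A \<and> card A = k then \<chi> A else undefined)" for A
  define col where "col E = restrict (\<lambda>T. \<chi>' (map decode ` subst_finite 3 E ` T)) \<T>" for E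
  have "finite \<T>"
    using finite_lists_length_le[of "{..<3::nat}" M] by (simp add: \<T>_def lists_eq_set)
  have "range \<chi>' \<subseteq> insert undefined (\<chi> ` {A. finite A \<and> card A = k})"
    by (auto simp: \<chi>'_def)
  then have "finite (range \<chi>')" using assms(2) by (meson finite_insert finite_subset)
  then have "finite (\<T> \<rightarrow>\<^sub>E range \<chi>')" using \<open>finite \<T>\<close> by (intro finite_PiE) auto
  moreover have "range col \<subseteq> \<T> \<rightarrow>\<^sub>E range \<chi>'" by (auto simp: col_def)
  ultimately have "finite (range col)" by (rule finite_subset[rotated])
  then obtain W where W: "omega_word 3 W" and mono: "\<And>m E E'. m \<le> M \<Longrightarrow>
      E \<in> param_words 3 m \<Longrightarrow> E' \<in> param_words 3 m \<Longrightarrow> col (apply_word 3 W E) = col (apply_word 3 W E')"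
    using omega_word_monochromatic_le[of col 3 M] by blast
  have emb: "order_embedding (word_map W)" by (rule order_embedding_word_map[OF W])
  define T where "T S = {map letter_rank u | u. word_of u \<in> tau S}" for S
  have colour: "T S \<in> \<T> \<and> Max (length ` T S) \<le> M \<and>
      (\<exists>E\<in>param_words 3 (Max (length ` T S)). \<chi> A = col (apply_word 3 W E) (T S))"
    if A: "A \<subseteq> range (word_map W)" "finite A" "card A = k" and S: "S = word_map W -` A" for A S
  proof -
    have AS: "A = word_map W ` S" using A(1) S by blast
    have "finite S" unfolding S using A(2) inj_word_map[OF W] by (rule finite_vimageI)
    have "card S = k" using A(3) AS inj_word_map[OF W] by (metis card_image inj_on_subset subset_UNIV)
    then have "S \<noteq> {}" using assms(1) by auto
    note rep = tau_representation[OF \<open>finite S\<close> \<open>S \<noteq> {}\<close>, folded T_def, unfolded \<open>card S = k\<close>, folded M_def]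
    have "T S \<in> \<T>" using rep(1) by (simp add: \<T>_def)
    moreover have "finite (T S)"
      using \<open>finite \<T>\<close> \<open>T S \<in> \<T>\<close> rep(1) unfolding \<T>_def by (meson finite_Pow_iff finite_subset)
    then have "Max (length ` T S) \<le> M" using rep(1,2) by auto
    moreover obtain E where E: "E \<in> param_words 3 (Max (length ` T S))" "map letter_rank ` S = subst_finite 3 E ` T S"
      using rep(3) by blast
    have "A = map decode ` apply_word 3 W ` map letter_rank ` S"
      unfolding AS by (simp add: word_map_def image_image)
    then have "A = map decode ` subst_finite 3 (apply_word 3 W E) ` T S"
      unfolding E(2) by (simp add: subst_finite_apply_word[OF W] image_image)
    then have "\<chi> A = col (apply_word 3 W E) (T S)"
      using A(2,3) \<open>T S \<in> \<T>\<close> by (simp add: col_def \<chi>'_def)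
    ultimately show ?thesis using E(1) by blast
  qed
  have "\<chi> A = \<chi> A'" if "A \<subseteq> range (word_map W)" "A' \<subseteq> range (word_map W)"
    "finite A" "card A = k" "finite A'" "card A' = k"
    "tau (word_map W -` A) = tau (word_map W -` A')" for A A'
  proof -
    \<comment> \<open>Equal sets \<open>T\<close> have equal maximal length, so the two words
      \<open>E\<close> have equally many parameters and \<open>mono\<close> applies.\<close>
    have "T (word_map W -` A) = T (word_map W -` A')" using that(7) by (simp add: T_def)
    then show ?thesis
      using colour[OF that(1,3,4) refl] colour[OF that(2,5,6) refl] mono by metis
  qed
  then show ?thesis using emb by blast
qed

end
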